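(* Suppose $R$ is a $\Phi$-structured and fibrous poset. Let $J\subseteq I$ and $\nu=\sum_{j\in J}\nu_j\omega_j^J\in\Lambda_{\Phi_J}^+$, and suppose $R$ has a $(J,\nu)$-coloring function $\kappa:R\setminus\mathcal M_{J,\nu}(R)\to J$. Then $R$ is a $(J,\nu)$-splitting poset with $$\chi^{\Phi_J}_\nu\cdot\mathrm{WGF}(R)|_J=\sum_{\mathbf m\in\mathcal M_{J,\nu}(R)}\chi^{\Phi_J}_{\nu+wt^J(\mathbf m)}.$$
   Context: Root systems. $\Phi$ is a finite (reduced, crystallographic) root system in a Euclidean space with simple roots $\{\alpha_i\}_{i\in I}$, $\alpha^\vee=2\alpha/\langle\alpha,\alpha\rangle$, fundamental weights $\omega_i$ dual to simple coroots, $\Lambda=\bigoplus\mathbb Z\omega_i$, $\Lambda^+=\bigoplus\mathbb Z_{\ge0}\omega_i$, Weyl group $W$, $\varrho=\sum\omega_i$. $\mathbb Z[\Lambda]$ is the group ring with basis $\{e^\mu\}$; $\mathcal A(e^\mu)=\sum_{w\in W}\det(w)e^{w(\mu)}$. For $\lambda\in\Lambda^+$ the Weyl bialternant $\chi_\lambda$ is the unique element of $\mathbb Z[\Lambda]$ with $\mathcal A(e^\varrho)\chi_\lambda=\mathcal A(e^{\lambda+\varrho})$. For $J\subseteq I$, $\Phi_J$ is the root subsystem with simple roots $\{\alpha_j\}_{j\in J}$, with fundamental weights $\omega_j^J$, weight lattice $\Lambda_{\Phi_J}$, dominant weights $\Lambda_{\Phi_J}^+$, bialternants $\chi^{\Phi_J}_\nu$.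 For $\mu=\sum m_i\omega_i$ put $\mu^J=\sum_{j\in J}m_j\omega_j^J$, and for $\chi=\sum c_\mu e^\mu$ put $\chi|_J=\sum c_\mu e^{\mu^J}$. Posets. All posets are finite, identified with Hasse diagrams. Ranked means there is a surjection $\rho:R\to\{0,\dots,l\}$ with $\rho(\mathbf s)+1=\rho(\mathbf t)$ whenever $\mathbf s\to\mathbf t$; $l$ is the length. For a ranked poset with Hasse edges colored by $I$, $\mathrm{comp}_i(\mathbf x)$ is the connected component of $\mathbf x$ using only color $i$ edges; $\rho_i(\mathbf x)$ is the rank of $\mathbf x$ there, $l_i(\mathbf x)$ its length, $\delta_i=l_i-\rho_i$, $m_i=\rho_i-\delta_i$, $wt^J(\mathbf x)=\sum_{j\in J}m_j(\mathbf x)\omega_j^J$, $wt=wt^I$, $\mathrm{WGF}(R)=\sum_{\mathbf x}e^{wt(\mathbf x)}$. $R$ is $\Phi$-structured if it is ranked, edge-colored by $I$, and $wt(\mathbf s)+\alpha_i=wt(\mathbf t)$ whenever $\mathbf s\xrightarrow{i}\mathbf t$; fibrous if every $\mathrm{comp}_i(\mathbf x)$ is a chain. A $(J,\nu)$-splitting poset is a $\Phi$-structured poset $R$ with a subset $\mathcal S_{J,\nu}(R)$ such that $\nu+wt^J(\mathbf s)\in\Lambda_{\Phi_J}^+$ for all $\mathbf s\in\mathcal S_{J,\nu}(R)$ and $\chi^{\Phi_J}_\nu\cdot\mathrm{WGF}(R)|_J=\sum_{\mathbf s\in\mathcal S_{J,\nu}(R)}\chi^{\Phi_J}_{\nu+wt^J(\mathbf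 s)}$ (here $\mathcal S_{J,\nu}(R)=\mathcal M_{J,\nu}(R)$). For fibrous $R$: $\mathcal M_{J,\nu}(R)=\{\mathbf m\in R:\delta_j(\mathbf m)\le\nu_j\ \forall j\in J\}$. For an integer $p\ge0$, $U_i(\mathbf x,p)$ is the set of the topmost $1+p$ elements of the chain $\mathrm{comp}_i(\mathbf x)$ (all of it if it has fewer than $1+p$ elements). A $(J,\nu)$-coloring of $R$ is a function $\kappa:R\setminus\mathcal M_{J,\nu}(R)\to J$ such that for all $\mathbf x\in R\setminus\mathcal M_{J,\nu}(R)$, with $j=\kappa(\mathbf x)$, $\{\mathbf y\in\mathrm{comp}_j(\mathbf x):\mathbf y\notin\mathcal M_{J,\nu}(R),\ \kappa(\mathbf y)=j\}=\mathrm{comp}_j(\mathbf x)\setminus U_j(\mathbf x,\nu_j)$. *)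

theory Defs
  imports "HOL-Analysis.Analysis" "HOL-Library.Poly_Mapping"
begin

section \<open>Root systems\<close>

definition coroot :: "real^'n \<Rightarrow> real^'n" where
  "coroot a = (2 / (a \<bullet> a)) *\<^sub>R a"

definition root_reflection :: "real^'n \<Rightarrow> real^'n \<Rightarrow> real^'n" where
  "root_reflection a v = v - (v \<bullet> coroot a) *\<^sub>R a"

text \<open>The roots are not required to span the ambient space, so that the root subsystems
  generated by some of the simple roots are root systems of the same ambient space.  (This also
  covers the empty root system.)\<close>

definition root_system :: "(real^'n) set \<Rightarrow> bool" where
  "root_system \<Phi> \<longleftrightarrow> finite \<Phi> \<and> 0 \<notin> \<Phi>
     \<and> (\<forall>a\<in>\<Phi>. root_reflection a ` \<Phi> = \<Phi>)
     \<and> (\<forall>a\<in>\<Phi>. \<forall>b\<in>\<Phi>. b \<bullet> coroot a \<in> \<int>)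
     \<and> (\<forall>a\<in>\<Phi>. \<forall>c::real. c *\<^sub>R a \<in> \<Phi> \<longrightarrow> c = 1 \<or> c = - 1)"

record ('e, 'i) root_datum =
  roots :: "'e set"
  colors :: "'i set"
  simple :: "'i \<Rightarrow> 'e"

definition based_root_system :: "(real^'n, 'i) root_datum \<Rightarrow> bool" where
  "based_root_system P \<longleftrightarrow> root_system (roots P)
     \<and> inj_on (simple P) (colors P) \<and> simple P ` colors P \<subseteq> roots P
     \<and> independent (simple P ` colors P)
     \<and> (\<forall>b\<in>roots P. \<exists>c :: 'i \<Rightarrow> int. b = (\<Sum>i\<in>colors P. of_int (c i) *\<^sub>R simple P i)
           \<and> ((\<forall>i\<in>colors P. 0 \<le> c i) \<or> (\<forall>i\<in>colors P. c i \<le> 0)))"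

definition root_subsystem :: "(real^'n, 'i) root_datum \<Rightarrow> 'i set \<Rightarrow> (real^'n, 'i) root_datum" where
  "root_subsystem P J = \<lparr>roots = roots P \<inter> span (simple P ` J), colors = J, simple = simple P\<rparr>"

text \<open>The fundamental weights are the basis of the span of the roots that is dual to the simple
  coroots.  For a proper subsystem they differ in general from those of the whole system.\<close>

definition fund_weight :: "(real^'n, 'i) root_datum \<Rightarrow> 'i \<Rightarrow> real^'n" where
  "fund_weight P i = (THE w. w \<in> span (simple P ` colors P)
     \<and> (\<forall>k\<in>colors P. w \<bullet> coroot (simple P k) = (if k = i then 1 else 0)))"

definition weight_lattice :: "(real^'n, 'i) root_datum \<Rightarrow> (real^'n) set" where
  "weight_lattice P = {\<Sum>i\<in>colors P. of_int (m i) *\<^sub>R fund_weight P i | m :: 'i \<Rightarrow> int. True}"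

definition dominant_weights :: "(real^'n, 'i) root_datum \<Rightarrow> (real^'n) set" where
  "dominant_weights P = {\<Sum>i\<in>colors P. of_nat (m i) *\<^sub>R fund_weight P i | m :: 'i \<Rightarrow> nat. True}"

definition weyl_vector :: "(real^'n, 'i) root_datum \<Rightarrow> real^'n" where
  "weyl_vector P = (\<Sum>i\<in>colors P. fund_weight P i)"

inductive_set weyl_group :: "(real^'n) set \<Rightarrow> (real^'n \<Rightarrow> real^'n) set" for \<Phi> where
  weyl_id: "id \<in> weyl_group \<Phi>"
| weyl_reflection: "a \<in> \<Phi> \<Longrightarrow> w \<in> weyl_group \<Phi> \<Longrightarrow> root_reflection a \<circ> w \<in> weyl_group \<Phi>"

section \<open>Weyl bialternants\<close>

text \<open>The group ring of the weight lattice is the subring of the group ring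
  \<open>real^'n \<Rightarrow>\<^sub>0 int\<close> formed by the elements supported on the lattice; the
  basis element \<open>e^\<mu>\<close> is \<open>Poly_Mapping.single \<mu> 1\<close>.\<close>

abbreviation expo :: "real^'n \<Rightarrow> (real^'n \<Rightarrow>\<^sub>0 int)" where
  "expo \<mu> \<equiv> Poly_Mapping.single \<mu> 1"

text \<open>The determinant of a Weyl group element is \<open>1\<close> or \<open>-1\<close>; the floor only serves to turn
  this real number into an integer coefficient.\<close>

definition alternant :: "(real^'n, 'i) root_datum \<Rightarrow> real^'n \<Rightarrow> (real^'n \<Rightarrow>\<^sub>0 int)" where
  "alternant P \<mu> = (\<Sum>w\<in>weyl_group (roots P). Poly_Mapping.single (w \<mu>) \<lfloor>det (matrix w)\<rfloor>)"

definition bialternant :: "(real^'n, 'i) root_datum \<Rightarrow> real^'n \<Rightarrow> (real^'n \<Rightarrow>\<^sub>0 int)" where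
  "bialternant P lam = (THE ch. Poly_Mapping.keys ch \<subseteq> weight_lattice P
     \<and> alternant P (weyl_vector P) * ch = alternant P (lam + weyl_vector P))"

text \<open>By duality the coefficient of the \<open>j\<close>-th fundamental weight in a weight \<open>\<mu>\<close> is the inner
  product of \<open>\<mu>\<close> with the \<open>j\<close>-th simple coroot; see \<open>restrict_weight_sum\<close> below.\<close>

definition restrict_weight :: "(real^'n, 'i) root_datum \<Rightarrow> 'i set \<Rightarrow> real^'n \<Rightarrow> real^'n" where
  "restrict_weight P J \<mu> =
     (\<Sum>j\<in>J. (\<mu> \<bullet> coroot (simple P j)) *\<^sub>R fund_weight (root_subsystem P J) j)"

definition restrict_char ::
    "(real^'n, 'i) root_datum \<Rightarrow> 'i set \<Rightarrow> (real^'n \<Rightarrow>\<^sub>0 int) \<Rightarrow> (real^'n \<Rightarrow>\<^sub>0 int)" where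
  "restrict_char P J ch =
     (\<Sum>\<mu>\<in>Poly_Mapping.keys ch. Poly_Mapping.single (restrict_weight P J \<mu>) (Poly_Mapping.lookup ch \<mu>))"

lemma finite_colors: "based_root_system P \<Longrightarrow> finite (colors P)"
  unfolding based_root_system_def root_system_def
  by (meson finite_imageD finite_subset)

lemma fund_weight_dual:
  fixes P :: "(real^'n, 'i) root_datum"
  assumes "based_root_system P" "i \<in> colors P"
  shows "fund_weight P i \<in> span (simple P ` colors P)"
    and "k \<in> colors P \<Longrightarrow> fund_weight P i \<bullet> coroot (simple P k) = (if k = i then 1 else 0)"
proof -
  let ?S = "simple P ` colors P"
  have nz: "simple P k \<noteq> 0" if "k \<in> colors P" for k
    using assms(1) that by (auto simp: based_root_system_def root_system_def)
  have inj: "inj_on (simple P) (colors P)" and ind: "independent ?S"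
    using assms(1) by (auto simp: based_root_system_def)
  obtain g :: "real^'n \<Rightarrow> real" where g: "linear g"
    "\<And>x. x \<in> ?S \<Longrightarrow> g x = (if x = simple P i then (simple P i \<bullet> simple P i) / 2 else 0)"
    using linear_independent_extend[OF ind,
        of "\<lambda>x. if x = simple P i then (simple P i \<bullet> simple P i) / 2 else 0"] by blast
  define u where "u = adjoint g 1"
  have u: "x \<bullet> u = g x" for x
    using adjoint_works[OF g(1), of x 1] by (simp add: u_def)
  obtain w z where wz: "w \<in> span ?S" "\<And>y. y \<in> span ?S \<Longrightarrow> orthogonal z y" "u = w + z"
    using orthogonal_subspace_decomp_exists[of ?S u] by metis
  have w: "w \<bullet> coroot (simple P k) = (if k = i then 1 else 0)" if k: "k \<in> colors P" for k
  proof -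
    have "simple P k \<in> span ?S" using k by (simp add: span_base)
    then have "z \<bullet> simple P k = 0" using wz(2) by (simp add: orthogonal_def)
    then have "w \<bullet> simple P k = g (simple P k)"
      using u[of "simple P k"] wz(3) by (simp add: inner_add_right inner_commute)
    also have "\<dots> = (if k = i then (simple P i \<bullet> simple P i) / 2 else 0)"
      using g(2) k assms(2) inj by (auto simp: inj_on_eq_iff)
    finally show ?thesis using nz[OF k] by (auto simp: coroot_def)
  qed
  have uniq: "v = w" if v: "v \<in> span ?S"
    "\<forall>k\<in>colors P. v \<bullet> coroot (simple P k) = (if k = i then 1 else 0)" for v
  proof -
    have d: "v - w \<in> span ?S" using v(1) wz(1) by (rule span_diff)
    have "orthogonal (v - w) x" if x: "x \<in> ?S" for x
    proof -
      obtain k where k: "k \<in> colors P" "x = simple P k" using x by blast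
      have "(v - w) \<bullet> coroot (simple P k) = 0"
        using v(2) w k(1) by (simp add: inner_diff_left)
      then show ?thesis using nz[OF k(1)] k(2) by (simp add: coroot_def orthogonal_def)
    qed
    then have "orthogonal (v - w) (v - w)"
      using d by (intro orthogonal_to_span[of "v - w" ?S]) auto
    then show ?thesis by (simp add: orthogonal_def)
  qed
  have "fund_weight P i = w"
    unfolding fund_weight_def
  proof (rule the_equality)
    show "w \<in> span ?S \<and> (\<forall>k\<in>colors P. w \<bullet> coroot (simple P k) = (if k = i then 1 else 0))"
      using wz(1) w by blast
  qed (use uniq in blast)
  then show "fund_weight P i \<in> span ?S"
    and "k \<in> colors P \<Longrightarrow> fund_weight P i \<bullet> coroot (simple P k) = (if k = i then 1 else 0)"
    using wz(1) w by blast+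
qed

lemma restrict_weight_sum:
  assumes "based_root_system P" "J \<subseteq> colors P"
  shows "restrict_weight P J (\<Sum>i\<in>colors P. m i *\<^sub>R fund_weight P i)
    = (\<Sum>j\<in>J. m j *\<^sub>R fund_weight (root_subsystem P J) j)"
proof -
  have "(\<Sum>i\<in>colors P. m i *\<^sub>R fund_weight P i) \<bullet> coroot (simple P j) = m j" if "j \<in> J" for j
  proof -
    have j: "j \<in> colors P" using that assms(2) by blast
    have "(\<Sum>i\<in>colors P. m i *\<^sub>R fund_weight P i) \<bullet> coroot (simple P j)
        = (\<Sum>i\<in>colors P. if i = j then m i else 0)"
      unfolding inner_sum_left
      by (rule sum.cong) (auto simp: fund_weight_dual(2)[OF assms(1) _ j])
    also have "\<dots> = m j" using finite_colors[OF assms(1)] j by simp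
    finally show ?thesis .
  qed
  then show ?thesis unfolding restrict_weight_def by (intro sum.cong) auto
qed

section \<open>Edge-colored ranked posets\<close>

record ('v, 'i) colored_poset =
  elems :: "'v set"
  order_rel :: "'v rel"
  color :: "'v \<times> 'v \<Rightarrow> 'i"

definition finite_poset :: "('v, 'i) colored_poset \<Rightarrow> bool" where
  "finite_poset R \<longleftrightarrow> finite (elems R) \<and> partial_order_on (elems R) (order_rel R)"

definition hasse_edges :: "('v, 'i) colored_poset \<Rightarrow> 'v rel" where
  "hasse_edges R = {(s, t). s \<in> elems R \<and> t \<in> elems R \<and> s \<noteq> t \<and> (s, t) \<in> order_rel R
     \<and> \<not> (\<exists>u\<in>elems R. u \<noteq> s \<and> u \<noteq> t \<and> (s, u) \<in> order_rel R \<and> (u, t) \<in> order_rel R)}"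

definition color_edges :: "('v, 'i) colored_poset \<Rightarrow> 'i \<Rightarrow> 'v rel" where
  "color_edges R i = {e \<in> hasse_edges R. color R e = i}"

text \<open>\<open>rank_function V E \<rho> l\<close>: \<open>\<rho>\<close> is a rank function of length \<open>l\<close> on the Hasse diagram with vertex
  set \<open>V\<close> and those edges of \<open>E\<close> that have both ends in \<open>V\<close>.\<close>

definition rank_function :: "'v set \<Rightarrow> 'v rel \<Rightarrow> ('v \<Rightarrow> nat) \<Rightarrow> nat \<Rightarrow> bool" where
  "rank_function V E \<rho> l \<longleftrightarrow> \<rho> ` V = {0..l}
     \<and> (\<forall>s\<in>V. \<forall>t\<in>V. (s, t) \<in> E \<longrightarrow> \<rho> s + 1 = \<rho> t)"

definition ranked_poset :: "('v, 'i) colored_poset \<Rightarrow> bool" where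
  "ranked_poset R \<longleftrightarrow> finite_poset R \<and> (\<exists>\<rho> l. rank_function (elems R) (hasse_edges R) \<rho> l)"

definition color_comp :: "('v, 'i) colored_poset \<Rightarrow> 'i \<Rightarrow> 'v \<Rightarrow> 'v set" where
  "color_comp R i x = {y \<in> elems R. (x, y) \<in> (color_edges R i \<union> (color_edges R i)\<inverse>)\<^sup>*}"

text \<open>A component is connected, so its rank function is unique on it.\<close>

definition comp_rank :: "('v, 'i) colored_poset \<Rightarrow> 'i \<Rightarrow> 'v \<Rightarrow> nat" where
  "comp_rank R i x =
     (THE r. \<exists>\<rho> l. rank_function (color_comp R i x) (color_edges R i) \<rho> l \<and> \<rho> x = r)"

definition comp_length :: "('v, 'i) colored_poset \<Rightarrow> 'i \<Rightarrow> 'v \<Rightarrow> nat" where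
  "comp_length R i x = (THE l. \<exists>\<rho>. rank_function (color_comp R i x) (color_edges R i) \<rho> l)"

definition comp_depth :: "('v, 'i) colored_poset \<Rightarrow> 'i \<Rightarrow> 'v \<Rightarrow> nat" where
  "comp_depth R i x = comp_length R i x - comp_rank R i x"

definition comp_mult :: "('v, 'i) colored_poset \<Rightarrow> 'i \<Rightarrow> 'v \<Rightarrow> int" where
  "comp_mult R i x = int (comp_rank R i x) - int (comp_depth R i x)"

text \<open>\<open>wt (root_subsystem P J) R x\<close> is the weight \<open>wt\<^sup>J(x)\<close>, and \<open>wt P R x\<close> is \<open>wt(x)\<close>.\<close>

definition wt :: "(real^'n, 'i) root_datum \<Rightarrow> ('v, 'i) colored_poset \<Rightarrow> 'v \<Rightarrow> real^'n" where
  "wt P R x = (\<Sum>i\<in>colors P. of_int (comp_mult R i x) *\<^sub>R fund_weight P i)"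

definition WGF :: "(real^'n, 'i) root_datum \<Rightarrow> ('v, 'i) colored_poset \<Rightarrow> (real^'n \<Rightarrow>\<^sub>0 int)" where
  "WGF P R = (\<Sum>x\<in>elems R. expo (wt P R x))"

definition structured_poset :: "(real^'n, 'i) root_datum \<Rightarrow> ('v, 'i) colored_poset \<Rightarrow> bool" where
  "structured_poset P R \<longleftrightarrow> ranked_poset R \<and> color R ` hasse_edges R \<subseteq> colors P
     \<and> (\<forall>i\<in>colors P. \<forall>(s, t)\<in>color_edges R i. wt P R s + simple P i = wt P R t)"

text \<open>A component is ordered by the paths of edges of its own color.\<close>

definition fibrous :: "(real^'n, 'i) root_datum \<Rightarrow> ('v, 'i) colored_poset \<Rightarrow> bool" where
  "fibrous P R \<longleftrightarrow> (\<forall>i\<in>colors P. \<forall>x\<in>elems R. \<forall>y\<in>color_comp R i x. \<forall>z\<in>color_comp R i x.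
     (y, z) \<in> (color_edges R i)\<^sup>* \<or> (z, y) \<in> (color_edges R i)\<^sup>*)"

definition splitting_poset :: "(real^'n, 'i) root_datum \<Rightarrow> 'i set \<Rightarrow> real^'n \<Rightarrow>
    ('v, 'i) colored_poset \<Rightarrow> 'v set \<Rightarrow> bool" where
  "splitting_poset P J \<nu> R S \<longleftrightarrow> structured_poset P R
     \<and> J \<subseteq> colors P \<and> \<nu> \<in> dominant_weights (root_subsystem P J) \<and> S \<subseteq> elems R
     \<and> (\<forall>s\<in>S. \<nu> + wt (root_subsystem P J) R s \<in> dominant_weights (root_subsystem P J))
     \<and> bialternant (root_subsystem P J) \<nu> * restrict_char P J (WGF P R)
         = (\<Sum>s\<in>S. bialternant (root_subsystem P J) (\<nu> + wt (root_subsystem P J) R s))"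

section \<open>Colorings\<close>

text \<open>In the following \<open>n j\<close> is the \<open>j\<close>-th coordinate of the dominant weight \<open>\<nu>\<close>.\<close>

definition max_set :: "('v, 'i) colored_poset \<Rightarrow> 'i set \<Rightarrow> ('i \<Rightarrow> nat) \<Rightarrow> 'v set" where
  "max_set R J n = {m \<in> elems R. \<forall>j\<in>J. comp_depth R j m \<le> n j}"

text \<open>The topmost \<open>1 + p\<close> elements of a chain are those with at most \<open>p\<close> elements above them.\<close>

definition top_part :: "('v, 'i) colored_poset \<Rightarrow> 'i \<Rightarrow> 'v \<Rightarrow> nat \<Rightarrow> 'v set" where
  "top_part R i x p = {y \<in> color_comp R i x. card {z \<in> color_comp R i x. (y, z) \<in> (color_edges R i)\<^sup>+} \<le> p}"

definition poset_coloring ::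
    "('v, 'i) colored_poset \<Rightarrow> 'i set \<Rightarrow> ('i \<Rightarrow> nat) \<Rightarrow> ('v \<Rightarrow> 'i) \<Rightarrow> bool" where
  "poset_coloring R J n \<kappa> \<longleftrightarrow> \<kappa> ` (elems R - max_set R J n) \<subseteq> J
     \<and> (\<forall>x\<in>elems R - max_set R J n.
          {y \<in> color_comp R (\<kappa> x) x. y \<notin> max_set R J n \<and> \<kappa> y = \<kappa> x}
            = color_comp R (\<kappa> x) x - top_part R (\<kappa> x) x (n (\<kappa> x)))"

end

theory Submission
  imports Defs
begin

text \<open>Multiply both sides by the alternant of the Weyl vector \<open>\<rho>\<close> of \<open>\<Phi>\<^sub>J\<close>, which is not a
  zero divisor. Reversing the chains of color \<open>j\<close> realizes the \<open>j\<close>-th simple reflection, so the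
  restricted weight generating function is invariant under the Weyl group and the left side
  becomes the sum over \<open>x \<in> R\<close> of the alternants of \<open>\<nu> + \<rho> + wt\<^sup>J(x)\<close>. For \<open>x\<close> outside the set
  \<open>\<M>\<close>, reverse the part of the chain of color \<open>j = \<kappa>(x)\<close> through \<open>x\<close> below its top \<open>1 + \<nu>\<^sub>j\<close>
  elements: by the coloring condition this is an involution of the complement of \<open>\<M>\<close>, and it
  applies the \<open>j\<close>-th simple reflection to \<open>\<nu> + \<rho> + wt\<^sup>J(x)\<close>. So those terms cancel.

  The bialternants exist because every alternant is divisible by the one of \<open>\<rho>\<close>: this follows by
  induction on the norm of the weight, from the product with an orbit sum, using that a strictly
  dominant weight has trivial stabilizer.\<close>

section \<open>Reflections\<close>

lemma inner_coroot: "v \<bullet> coroot a = 2 * (v \<bullet> a) / (a \<bullet> a)"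
  by (simp add: coroot_def)

lemma root_reflection_alt: "root_reflection a v = v - (2 * (v \<bullet> a) / (a \<bullet> a)) *\<^sub>R a"
  by (simp add: root_reflection_def inner_coroot)

lemma root_reflection_self [simp]: "root_reflection a a = - a"
  by (cases "a = 0") (simp_all add: root_reflection_alt scaleR_2)

lemma root_reflection_involution [simp]: "root_reflection a (root_reflection a v) = v"
  by (cases "a = 0") (simp_all add: root_reflection_alt inner_diff_left)

lemma root_reflection_comp_self [simp]: "root_reflection a \<circ> root_reflection a = id"
  by (simp add: fun_eq_iff)

lemma root_reflection_minus: "root_reflection (- a) = root_reflection a"
  by (simp add: root_reflection_alt fun_eq_iff)

lemma linear_root_reflection: "linear (root_reflection a)"
  by (rule linearI)
    (simp_all add: root_reflection_alt inner_add_left add_divide_distrib distrib_left algebra_simps)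

lemma inner_root_reflection:
  "root_reflection a u \<bullet> v = u \<bullet> v - (u \<bullet> coroot a) * (a \<bullet> v)"
  by (simp add: root_reflection_def inner_diff_left)

lemma orthogonal_root_reflection: "orthogonal_transformation (root_reflection a)"
proof -
  have "root_reflection a u \<bullet> root_reflection a v = u \<bullet> v" for u v
    by (cases "a = 0")
      (simp_all add: root_reflection_alt inner_diff_left inner_diff_right inner_commute)
  then show ?thesis
    by (simp add: orthogonal_transformation_def linear_root_reflection)
qed

text \<open>An isometry preserves the inner products in the formula for a reflection, so it carries
  the reflection in \<open>a\<close> to the one in \<open>w a\<close>.\<close>

lemma root_reflection_conj:
  assumes "orthogonal_transformation w"
  shows "root_reflection (w a) \<circ> w = w \<circ> root_reflection a"
  using assms orthogonal_transformation_linear[OF assms]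
  by (auto simp: fun_eq_iff root_reflection_alt orthogonal_transformation_def
      linear_diff linear_cmul)

section \<open>Determinants of reflections\<close>

lemma det_matrix_compose:
  fixes f g :: "real^'n \<Rightarrow> real^'n"
  assumes "linear f" "linear g"
  shows "det (matrix (f \<circ> g)) = det (matrix f) * det (matrix g)"
  using assms by (simp add: matrix_compose det_mul)

lemma det_orthogonal_transformation:
  fixes w :: "real^'n \<Rightarrow> real^'n"
  assumes "orthogonal_transformation w"
  shows "det (matrix w) = 1 \<or> det (matrix w) = - 1"
  using assms det_orthogonal_matrix orthogonal_transformation_matrix by blast

text \<open>Conjugating by an isometry that takes a basis vector to the direction of
  \<open>a\<close> preserves the determinant, and the reflection in a basis vector is diagonal with
  a single entry -1.\<close>

lemma det_root_reflection:
  fixes a :: "real^'n"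
  assumes "a \<noteq> 0"
  shows "det (matrix (root_reflection a)) = - 1"
proof -
  \<comment> \<open>Any coordinate serves; \<open>undefined\<close> merely picks one.\<close>
  define k :: 'n where "k = undefined"
  define e :: "real^'n" where "e = axis k 1"
  obtain T where T: "orthogonal_transformation T" "T e = (1 / norm a) *\<^sub>R a"
    using orthogonal_transformation_exists_1[of e "(1 / norm a) *\<^sub>R a"] assms
    by (auto simp: e_def)
  have lin: "linear T" and det: "det (matrix T) \<noteq> 0"
    using T det_orthogonal_transformation[OF T(1)] by (auto simp: orthogonal_transformation_linear)
  \<comment> \<open>A reflection depends only on the line through its root, so normalizing
    \<open>a\<close> is harmless.\<close>
  have "root_reflection (T e) = root_reflection a"
    using assms by (simp add: T fun_eq_iff root_reflection_alt power2_eq_square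
        flip: dot_square_norm)
  then have "root_reflection a \<circ> T = T \<circ> root_reflection e"
    using root_reflection_conj[OF T(1), of e] by simp
  then have "det (matrix (root_reflection a)) * det (matrix T)
      = det (matrix T) * det (matrix (root_reflection e))"
    using lin by (metis det_matrix_compose linear_root_reflection)
  then have eq: "det (matrix (root_reflection a)) = det (matrix (root_reflection e))"
    using det by simp
  have entry: "matrix (root_reflection e) $ i $ j
      = (if i = j then if i = k then - 1 else 1 else 0)" for i j
    by (auto simp: matrix_def root_reflection_alt e_def inner_axis_axis)
      (auto simp: axis_def)
  have "det (matrix (root_reflection e)) = (\<Prod>i\<in>UNIV. matrix (root_reflection e) $ i $ i)"
    by (rule det_diagonal) (simp add: entry)
  also have "\<dots> = (\<Prod>i\<in>UNIV. if i = k then - 1 else 1)"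
    by (simp add: entry)
  also have "\<dots> = - 1"
    by simp
  finally show ?thesis
    using eq by simp
qed

lemma linear_comb_unique:
  fixes f :: "'i \<Rightarrow> 'a::euclidean_space"
  assumes "finite I" "inj_on f I" "independent (f ` I)"
    and eq: "(\<Sum>i\<in>I. c i *\<^sub>R f i) = (\<Sum>i\<in>I. d i *\<^sub>R f i)" and "i \<in> I"
  shows "c i = d i"
proof -
  define g where "g v = c (inv_into I f v) - d (inv_into I f v)" for v
  have "(\<Sum>v\<in>f ` I. g v *\<^sub>R v) = (\<Sum>i\<in>I. (c i - d i) *\<^sub>R f i)"
    using assms(2) by (simp add: sum.reindex g_def inv_into_f_f cong: sum.cong)
  also have "\<dots> = 0"
    using eq by (simp add: scaleR_diff_left sum_subtractf)
  finally have "g (f i) = 0"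
    using assms(1,3,5) by (simp add: independent_explicit)
  then show ?thesis
    using assms(2,5) by (simp add: g_def)
qed

section \<open>Weyl groups\<close>

lemma weyl_group_orthogonal: "w \<in> weyl_group \<Phi> \<Longrightarrow> orthogonal_transformation w"
proof (induction rule: weyl_group.induct)
  case weyl_id
  then show ?case by (simp add: id_def)
next
  case (weyl_reflection a w)
  then show ?case
    by (intro orthogonal_transformation_compose orthogonal_root_reflection)
qed

lemma weyl_group_comp:
  "v \<in> weyl_group \<Phi> \<Longrightarrow> w \<in> weyl_group \<Phi> \<Longrightarrow> v \<circ> w \<in> weyl_group \<Phi>"
  by (induction rule: weyl_group.induct) (auto simp: comp_assoc intro: weyl_group.intros)

lemma root_reflection_in_weyl_group: "a \<in> \<Phi> \<Longrightarrow> root_reflection a \<in> weyl_group \<Phi>"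
  using weyl_group.intros(2)[OF _ weyl_group.intros(1)] by fastforce

section \<open>Coordinates in the span of the simple roots\<close>

locale based_roots =
  fixes P :: "(real^'n, 'i) root_datum"
  assumes based: "based_root_system P"
begin

abbreviation refl :: "'i \<Rightarrow> real^'n \<Rightarrow> real^'n" where
  "refl i \<equiv> root_reflection (simple P i)"

abbreviation \<rho> :: "real^'n" where
  "\<rho> \<equiv> weyl_vector P"

abbreviation W :: "(real^'n \<Rightarrow> real^'n) set" where
  "W \<equiv> weyl_group (roots P)"

text \<open>Weyl group elements are spelled out as lists of colors so that arguments can use the
  length of a list.\<close>

definition word :: "'i list \<Rightarrow> real^'n \<Rightarrow> real^'n" where
  "word l = foldr (\<lambda>i. (\<circ>) (refl i)) l id"

lemma word_simps [simp]:
  "word [] = id" "word (i # l) = refl i \<circ> word l"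
  by (simp_all add: word_def)

lemma finite_I: "finite (colors P)"
  using based by (rule finite_colors)

lemma finite_roots: "finite (roots P)"
  using based by (simp add: based_root_system_def root_system_def)

lemma root_nonzero: "b \<in> roots P \<Longrightarrow> b \<noteq> 0"
  using based by (auto simp: based_root_system_def root_system_def)

lemma simple_root: "i \<in> colors P \<Longrightarrow> simple P i \<in> roots P"
  using based by (auto simp: based_root_system_def)

lemma simple_nonzero: "i \<in> colors P \<Longrightarrow> simple P i \<noteq> 0"
  using root_nonzero simple_root by blast

lemma reflection_root: "a \<in> roots P \<Longrightarrow> b \<in> roots P \<Longrightarrow> root_reflection a b \<in> roots P"
  using based by (auto simp: based_root_system_def root_system_def)

lemma minus_root: "a \<in> roots P \<Longrightarrow> - a \<in> roots P"
  using reflection_root[of a a] by simp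

lemma root_integral: "a \<in> roots P \<Longrightarrow> b \<in> roots P \<Longrightarrow> b \<bullet> coroot a \<in> \<int>"
  using based by (auto simp: based_root_system_def root_system_def)

lemma root_expansion:
  assumes "b \<in> roots P"
  obtains c :: "'i \<Rightarrow> int" where "b = (\<Sum>i\<in>colors P. of_int (c i) *\<^sub>R simple P i)"
    "(\<forall>i\<in>colors P. 0 \<le> c i) \<or> (\<forall>i\<in>colors P. c i \<le> 0)"
  using based assms by (auto simp: based_root_system_def)

lemma simple_comb_unique:
  "(\<Sum>i\<in>colors P. c i *\<^sub>R simple P i) = (\<Sum>i\<in>colors P. d i *\<^sub>R simple P i)
    \<Longrightarrow> i \<in> colors P \<Longrightarrow> c i = d i"
  using linear_comb_unique[of "colors P" "simple P" c d i] based finite_I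
  by (simp add: based_root_system_def)

text \<open>The difference is orthogonal to the simple roots and lies in their span, hence is
  orthogonal to itself. Membership in the span matters because the roots may fail to span the
  ambient space.\<close>

lemma span_eqI:
  assumes "u \<in> span (simple P ` colors P)" "v \<in> span (simple P ` colors P)"
    and "\<And>k. k \<in> colors P \<Longrightarrow> u \<bullet> coroot (simple P k) = v \<bullet> coroot (simple P k)"
  shows "u = v"
proof -
  have "orthogonal (u - v) x" if "x \<in> simple P ` colors P" for x
    using that assms(3) simple_nonzero
    by (auto simp: orthogonal_def inner_coroot inner_diff_left)
  then have "orthogonal (u - v) (u - v)"
    using assms(1,2) by (intro orthogonal_to_span[of "u - v" "simple P ` colors P"]) (auto intro: span_diff)
  then show ?thesis by (simp add: orthogonal_def)
qed

lemma weight_comb_coroot: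
  assumes "k \<in> colors P"
  shows "(\<Sum>i\<in>colors P. m i *\<^sub>R fund_weight P i) \<bullet> coroot (simple P k) = m k"
proof -
  have "(\<Sum>i\<in>colors P. m i *\<^sub>R fund_weight P i) \<bullet> coroot (simple P k)
      = (\<Sum>i\<in>colors P. if i = k then m i else 0)"
    unfolding inner_sum_left
    by (rule sum.cong) (auto simp: fund_weight_dual(2)[OF based _ assms])
  then show ?thesis
    using finite_I assms by simp
qed

lemma weight_comb_span:
  "(\<Sum>i\<in>colors P. m i *\<^sub>R fund_weight P i) \<in> span (simple P ` colors P)"
  by (intro span_sum span_scale fund_weight_dual(1)[OF based])

lemma span_weight_comb:
  assumes "v \<in> span (simple P ` colors P)"
  shows "v = (\<Sum>i\<in>colors P. (v \<bullet> coroot (simple P i)) *\<^sub>R fund_weight P i)"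
  using assms weight_comb_span by (rule span_eqI) (simp add: weight_comb_coroot)

lemma weyl_vector_span: "\<rho> \<in> span (simple P ` colors P)"
  using weight_comb_span[of "\<lambda>_. 1"] by (simp add: weyl_vector_def)

lemma weyl_vector_coroot: "k \<in> colors P \<Longrightarrow> \<rho> \<bullet> coroot (simple P k) = 1"
  using weight_comb_coroot[of k "\<lambda>_. 1"] by (simp add: weyl_vector_def)

section \<open>Positive roots, measured by the pairing with \<open>\<rho>\<close>\<close>

lemma coroot_pos_iff:
  "k \<in> colors P \<Longrightarrow> 0 < v \<bullet> coroot (simple P k) \<longleftrightarrow> 0 < v \<bullet> simple P k"
  using inner_gt_zero_iff[of "simple P k"] simple_nonzero[of k]
  by (simp add: inner_coroot zero_less_divide_iff del: inner_gt_zero_iff)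

lemma simple_weyl_vector_pos: "k \<in> colors P \<Longrightarrow> 0 < simple P k \<bullet> \<rho>"
  using coroot_pos_iff[of k \<rho>] weyl_vector_coroot[of k] by (simp add: inner_commute)

text \<open>Positivity of a root is expressed by its inner product with \<open>\<rho>\<close>. Every
  simple root pairs positively with \<open>\<rho>\<close>, so coefficients that are all nonpositive
  are excluded.\<close>

lemma positive_root_expansion:
  assumes "b \<in> roots P" "0 < b \<bullet> \<rho>"
  obtains c :: "'i \<Rightarrow> int" where "b = (\<Sum>i\<in>colors P. of_int (c i) *\<^sub>R simple P i)"
    "\<forall>i\<in>colors P. 0 \<le> c i"
proof -
  obtain c :: "'i \<Rightarrow> int" where c: "b = (\<Sum>i\<in>colors P. of_int (c i) *\<^sub>R simple P i)"
    "(\<forall>i\<in>colors P. 0 \<le> c i) \<or> (\<forall>i\<in>colors P. c i \<le> 0)"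
    using root_expansion assms by metis
  have "\<not> (\<forall>i\<in>colors P. c i \<le> 0)"
  proof
    assume "\<forall>i\<in>colors P. c i \<le> 0"
    then have "b \<bullet> \<rho> \<le> 0"
      using simple_weyl_vector_pos unfolding c(1) inner_sum_left
      by (intro sum_nonpos) (auto simp: mult_nonpos_nonneg less_imp_le)
    then show False using assms by simp
  qed
  then show ?thesis using that c by blast
qed

text \<open>The coefficients of a root share one sign and the simple roots pair positively with
  \<open>\<rho>\<close>, so a zero pairing would make every coefficient vanish.\<close>

lemma root_weyl_vector_cases:
  assumes "b \<in> roots P"
  shows "0 < b \<bullet> \<rho> \<or> b \<bullet> \<rho> < 0"
proof -
  have False if 0: "b \<bullet> \<rho> = 0"
  proof -
    obtain c :: "'i \<Rightarrow> int" where c: "b = (\<Sum>i\<in>colors P. of_int (c i) *\<^sub>R simple P i)"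
      "(\<forall>i\<in>colors P. 0 \<le> c i) \<or> (\<forall>i\<in>colors P. c i \<le> 0)"
      using root_expansion assms by metis
    have sum0: "(\<Sum>i\<in>colors P. \<bar>of_int (c i)\<bar> * (simple P i \<bullet> \<rho>)) = 0"
      using c(2)
    proof
      assume "\<forall>i\<in>colors P. 0 \<le> c i"
      then show ?thesis using 0 by (simp add: c(1) inner_sum_left)
    next
      assume "\<forall>i\<in>colors P. c i \<le> 0"
      then show ?thesis using 0 by (simp add: c(1) inner_sum_left sum_negf)
    qed
    have "c i = 0" if i: "i \<in> colors P" for i
    proof -
      have "\<bar>real_of_int (c i)\<bar> * (simple P i \<bullet> \<rho>) = 0"
        using sum0 i finite_I simple_weyl_vector_pos
        by (subst (asm) sum_nonneg_eq_0_iff) (auto simp: less_imp_le)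
      then show ?thesis using simple_weyl_vector_pos[OF i] by simp
    qed
    then have "b = 0" by (simp add: c(1))
    then show False using root_nonzero assms by blast
  qed
  then show ?thesis using less_linear by blast
qed

text \<open>The reflection changes only the coefficient at \<open>i\<close>. If the image were
  negative, all other coefficients of \<open>b\<close> would vanish, and reducedness with positivity
  would leave only \<open>b = simple P i\<close>.\<close>

lemma simple_reflection_positive:
  assumes "b \<in> roots P" "0 < b \<bullet> \<rho>" "i \<in> colors P" "b \<noteq> simple P i"
  shows "0 < refl i b \<bullet> \<rho>"
proof (rule ccontr)
  assume neg: "\<not> 0 < refl i b \<bullet> \<rho>"
  have r: "refl i b \<in> roots P"
    using assms simple_root reflection_root by blast
  then have "0 < - refl i b \<bullet> \<rho>"
    using root_weyl_vector_cases[OF r] neg by simp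
  then obtain d :: "'i \<Rightarrow> int" where
    d: "- refl i b = (\<Sum>k\<in>colors P. of_int (d k) *\<^sub>R simple P k)" "\<forall>k\<in>colors P. 0 \<le> d k"
    using positive_root_expansion minus_root[OF r] by metis
  obtain c :: "'i \<Rightarrow> int" where
    c: "b = (\<Sum>k\<in>colors P. of_int (c k) *\<^sub>R simple P k)" "\<forall>k\<in>colors P. 0 \<le> c k"
    using positive_root_expansion assms by metis
  define p where "p = b \<bullet> coroot (simple P i)"
  have eq: "(\<Sum>k\<in>colors P. of_int (c k) *\<^sub>R simple P k)
      = (\<Sum>k\<in>colors P. ((if k = i then p else 0) - of_int (d k)) *\<^sub>R simple P k)"
  proof -
    have "b = p *\<^sub>R simple P i - (- refl i b)"
      by (simp add: root_reflection_def p_def)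
    also have "p *\<^sub>R simple P i = (\<Sum>k\<in>colors P. (if k = i then p else 0) *\<^sub>R simple P k)"
      using finite_I assms(3) by (simp add: if_distrib[of "\<lambda>x. x *\<^sub>R _"] cong: if_cong)
    finally show ?thesis
      by (simp add: c(1)[symmetric] d(1) scaleR_diff_left sum_subtractf)
  qed
  have c0: "c k = 0" if "k \<in> colors P" "k \<noteq> i" for k
  proof -
    have "real_of_int (c k) = - real_of_int (d k)"
      using simple_comb_unique[OF eq that(1)] that(2) by simp
    then have "c k = - d k" by linarith
    then show ?thesis using c(2) d(2) that(1) by fastforce
  qed
  have "b = (\<Sum>k\<in>colors P. if k = i then of_int (c i) *\<^sub>R simple P i else 0)"
    unfolding c(1) by (rule sum.cong) (auto simp: c0)
  then have bi: "b = of_int (c i) *\<^sub>R simple P i"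
    using finite_I assms(3) by simp
  moreover have "real_of_int (c i) = 1 \<or> real_of_int (c i) = - 1"
    using based assms(1,3) simple_root[OF assms(3)] bi
    unfolding based_root_system_def root_system_def by metis
  ultimately have "b = simple P i"
    using c(2) assms(3) by fastforce
  then show False using assms(4) by blast
qed

section \<open>Generation of the Weyl group by simple reflections\<close>

lemma word_append: "word (l @ l') = word l \<circ> word l'"
  by (induction l) (auto simp: comp_assoc)

lemma word_in_W: "set l \<subseteq> colors P \<Longrightarrow> word l \<in> W"
  by (induction l) (auto intro: weyl_group.intros simple_root)

lemma W_root: "w \<in> W \<Longrightarrow> b \<in> roots P \<Longrightarrow> w b \<in> roots P"
  by (induction rule: weyl_group.induct) (auto intro: reflection_root)

lemma word_root: "set l \<subseteq> colors P \<Longrightarrow> b \<in> roots P \<Longrightarrow> word l b \<in> roots P"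
  using word_in_W W_root by blast

text \<open>The exchange condition: the letter to be dropped is the one at which the image of
  \<open>simple P j\<close> becomes negative.\<close>

lemma exchange:
  assumes "set l \<subseteq> colors P" "j \<in> colors P" "word l (simple P j) \<bullet> \<rho> < 0"
  shows "\<exists>l'. set l' \<subseteq> colors P \<and> length l' < length l \<and> word l \<circ> refl j = word l'"
  using assms
proof (induction l)
  case Nil
  then show ?case using simple_weyl_vector_pos[of j] by simp
next
  case (Cons i l)
  show ?case
  proof (cases "word l (simple P j) \<bullet> \<rho> < 0")
    case True
    obtain l' where "set l' \<subseteq> colors P" "length l' < length l" "word l \<circ> refl j = word l'"
      using Cons.IH[OF _ Cons.prems(2) True] Cons.prems(1) by (metis insert_subset list.simps(15))
    then show ?thesis
      using Cons.prems(1) by (intro exI[of _ "i # l'"]) (simp add: comp_def fun_eq_iff)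
  next
    case False
    have root: "word l (simple P j) \<in> roots P"
      using Cons.prems by (intro word_root simple_root) auto
    then have "0 < word l (simple P j) \<bullet> \<rho>"
      using False root_weyl_vector_cases by blast
    \<comment> \<open>\<open>refl i\<close> makes this positive root negative, which it does to no
      positive root but \<open>simple P i\<close>.\<close>
    then have eq: "word l (simple P j) = simple P i"
      using simple_reflection_positive[OF root] Cons.prems by fastforce
    have "orthogonal_transformation (word l)"
      using Cons.prems by (intro weyl_group_orthogonal[of _ "roots P"] word_in_W) auto
    then have "word l \<circ> refl j = refl i \<circ> word l"
      using root_reflection_conj[of "word l" "simple P j"] eq by simp
    then have "word (i # l) \<circ> refl j = (refl i \<circ> refl i) \<circ> word l"
      by (simp add: comp_assoc del: root_reflection_comp_self)
    then have eq': "word (i # l) \<circ> refl j = word l"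
      by (simp only: root_reflection_comp_self id_comp)
    show ?thesis
      using Cons.prems(1) by (intro exI[of _ l] conjI eq') auto
  qed
qed

text \<open>A suitable simple reflection lowers a non-simple positive root and keeps it positive;
  conjugating the shorter case by it gives the word. The induction counts the positive roots with
  strictly smaller pairing with \<open>\<rho>\<close>.\<close>

lemma positive_reflection_word:
  assumes "b \<in> roots P" "0 < b \<bullet> \<rho>"
  shows "\<exists>l. set l \<subseteq> colors P \<and> root_reflection b = word l"
  using assms
proof (induction "card {c \<in> roots P. 0 < c \<bullet> \<rho> \<and> c \<bullet> \<rho> < b \<bullet> \<rho>}" arbitrary: b rule: less_induct)
  case less
  show ?case
  proof (cases "b \<in> simple P ` colors P")
    case True
    then obtain i where "i \<in> colors P" "b = simple P i" by blast
    then show ?thesis by (intro exI[of _ "[i]"]) simp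
  next
    case False
    obtain c :: "'i \<Rightarrow> int" where
      c: "b = (\<Sum>k\<in>colors P. of_int (c k) *\<^sub>R simple P k)" "\<forall>k\<in>colors P. 0 \<le> c k"
      using positive_root_expansion less.prems by metis
    \<comment> \<open>Expanding one factor of \<open>b \<bullet> b\<close> in simple roots yields a
      positive term, hence a simple root pairing positively with \<open>b\<close>; reflecting in it
      lowers \<open>b\<close>.\<close>
    have "0 < b \<bullet> b" using root_nonzero less.prems by simp
    also have "b \<bullet> b = (\<Sum>k\<in>colors P. of_int (c k) * (b \<bullet> simple P k))"
      by (subst (2) c(1)) (simp add: inner_sum_right)
    finally obtain i where i: "i \<in> colors P" "0 < of_int (c i) * (b \<bullet> simple P i)"
      by (meson not_le sum_nonpos)
    then have bi: "0 < b \<bullet> simple P i"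
      using c(2) by (auto simp: zero_less_mult_iff)
    let ?b = "refl i b"
    have b': "?b \<in> roots P" "0 < ?b \<bullet> \<rho>"
      using less.prems i False reflection_root simple_root simple_reflection_positive by blast+
    have lt: "?b \<bullet> \<rho> < b \<bullet> \<rho>"
      using bi i(1) coroot_pos_iff[of i b] simple_weyl_vector_pos[of i]
      by (simp add: inner_root_reflection)
    have "card {c \<in> roots P. 0 < c \<bullet> \<rho> \<and> c \<bullet> \<rho> < ?b \<bullet> \<rho>}
        < card {c \<in> roots P. 0 < c \<bullet> \<rho> \<and> c \<bullet> \<rho> < b \<bullet> \<rho>}"
      using finite_roots b' lt by (intro psubset_card_mono) auto
    then obtain l where l: "set l \<subseteq> colors P" "root_reflection ?b = word l"
      using less.hyps b' by blast
    \<comment> \<open>Since \<open>b = refl i ?b\<close>, the inserted identity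
      \<open>refl i \<circ> refl i\<close> lets the conjugation formula apply.\<close>
    have "root_reflection b = root_reflection (refl i ?b) \<circ> (refl i \<circ> refl i)"
      by (simp add: fun_eq_iff)
    also have "\<dots> = refl i \<circ> (root_reflection ?b \<circ> refl i)"
      using root_reflection_conj[OF orthogonal_root_reflection, of "simple P i" ?b]
      by (simp add: comp_assoc[symmetric] del: root_reflection_comp_self)
    also have "\<dots> = word (i # l @ [i])"
      by (simp only: l(2)) (simp add: word_append)
    finally show ?thesis
      using l(1) i(1) by (intro exI[of _ "i # l @ [i]"]) auto
  qed
qed

text \<open>A root or its negative is positive and both give the same reflection, so every generator
  is a word and products of generators are concatenations.\<close>

lemma W_word:
  assumes "w \<in> W"
  shows "\<exists>l. set l \<subseteq> colors P \<and> w = word l"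
  using assms
proof (induction rule: weyl_group.induct)
  case weyl_id
  show ?case by (intro exI[of _ "[]"]) simp
next
  case (weyl_reflection a w)
  obtain l where l: "set l \<subseteq> colors P" "w = word l" using weyl_reflection by blast
  obtain l' where l': "set l' \<subseteq> colors P" "root_reflection a = word l'"
  proof (cases "0 < a \<bullet> \<rho>")
    case True
    then show ?thesis using positive_reflection_word weyl_reflection(1) that by blast
  next
    case False
    then have "0 < (- a) \<bullet> \<rho>"
      using root_weyl_vector_cases[OF weyl_reflection(1)] by simp
    then show ?thesis
      using positive_reflection_word[OF minus_root[OF weyl_reflection(1)]] that
      by (auto simp: root_reflection_minus)
  qed
  show ?case using l l' by (intro exI[of _ "l' @ l"]) (simp add: word_append)
qed

text \<open>The defining induction allows reflections in arbitrary roots; this one reduces the step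
  to simple reflections.\<close>

lemma W_induct [consumes 1, case_names id refl]:
  assumes "w \<in> W" "Q id"
    and step: "\<And>i v. i \<in> colors P \<Longrightarrow> v \<in> W \<Longrightarrow> Q v \<Longrightarrow> Q (refl i \<circ> v)"
  shows "Q w"
proof -
  obtain l where "set l \<subseteq> colors P" "w = word l" using W_word[OF assms(1)] by blast
  then show ?thesis
  proof (induction l arbitrary: w)
    case Nil
    then show ?case using assms(2) by (simp only: word_simps(1))
  next
    case (Cons i l)
    then have "Q (refl i \<circ> word l)"
      by (intro step word_in_W) auto
    then show ?case using Cons.prems(2) by (simp only: word_simps)
  qed
qed

text \<open>An element is linear and fixes every vector orthogonal to the roots, so it is determined
  by its action on the finite set of roots.\<close>

lemma finite_W: "finite W"
proof (rule finite_imageD)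
  show "finite ((\<lambda>w. restrict w (roots P)) ` W)"
    by (rule finite_subset[of _ "roots P \<rightarrow>\<^sub>E roots P"])
      (auto simp: W_root finite_roots intro: finite_PiE)
next
  show "inj_on (\<lambda>w. restrict w (roots P)) W"
  proof (rule inj_onI)
    fix v w assume vw: "v \<in> W" "w \<in> W" "restrict v (roots P) = restrict w (roots P)"
    then have lin: "linear v" "linear w"
      by (auto intro: weyl_group_orthogonal orthogonal_transformation_linear)
    have on_roots: "v b = w b" if "b \<in> roots P" for b
      using vw(3) that by (metis restrict_apply')
    have on_span: "v b = w b" if "b \<in> span (roots P)" for b
      using linear_eq_on_span[OF lin on_roots that] .
    have orth: "u x = x" if u: "u \<in> W" and x: "\<And>b. b \<in> roots P \<Longrightarrow> x \<bullet> b = 0" for u x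
      using u by (induction rule: weyl_group.induct) (auto simp: root_reflection_alt x)
    show "v = w"
    proof
      fix x
      obtain y z where yz: "y \<in> span (roots P)" "\<And>b. b \<in> span (roots P) \<Longrightarrow> orthogonal z b"
        "x = y + z"
        using orthogonal_subspace_decomp_exists[of "roots P" x] by metis
      have "v z = z" "w z = z"
        using yz(2) vw by (auto intro!: orth simp: orthogonal_def span_base)
      then show "v x = w x"
        using on_span[OF yz(1)] by (simp add: yz(3) linear_add lin)
    qed
  qed
qed

section \<open>Dominant vectors and their orbits\<close>

lemma exists_dominant_conjugate:
  "\<exists>w\<in>W. \<forall>i\<in>colors P. 0 \<le> w v \<bullet> coroot (simple P i)"
proof -
  \<comment> \<open>A vector of the orbit with largest pairing with \<open>\<rho>\<close> is
    dominant: at a negative coordinate the simple reflection would increase the pairing.\<close>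
  obtain w where w: "w \<in> W" "\<And>u. u \<in> W \<Longrightarrow> u v \<bullet> \<rho> \<le> w v \<bullet> \<rho>"
  proof -
    have "finite ((\<lambda>u. u v \<bullet> \<rho>) ` W)" "(\<lambda>u. u v \<bullet> \<rho>) ` W \<noteq> {}"
      using finite_W weyl_group.weyl_id by auto
    from Max_in[OF this] obtain w where "w \<in> W" "w v \<bullet> \<rho> = Max ((\<lambda>u. u v \<bullet> \<rho>) ` W)"
      by auto
    then show ?thesis using that finite_W by simp
  qed
  have "0 \<le> w v \<bullet> coroot (simple P i)" if i: "i \<in> colors P" for i
  proof -
    have "refl i \<circ> w \<in> W"
      using w(1) i by (intro weyl_group.intros simple_root)
    from w(2)[OF this] have "0 \<le> (w v \<bullet> coroot (simple P i)) * (simple P i \<bullet> \<rho>)"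
      by (simp add: inner_root_reflection)
    then show ?thesis using simple_weyl_vector_pos[OF i] by (simp add: zero_le_mult_iff)
  qed
  then show ?thesis using w(1) by blast
qed

text \<open>If \<open>w = v \<circ> refl j\<close> where \<open>v\<close> keeps \<open>simple P j\<close> positive, then passing from \<open>v \<lambda>\<close> to
  \<open>w \<lambda>\<close> subtracts a nonnegative multiple of a positive root; otherwise the exchange condition
  shortens the word.\<close>

lemma dominant_orbit_word:
  assumes "\<And>i. i \<in> colors P \<Longrightarrow> 0 \<le> lam \<bullet> coroot (simple P i)" "set l \<subseteq> colors P"
  shows "word l lam \<bullet> \<rho> \<le> lam \<bullet> \<rho> \<and> (word l lam \<bullet> \<rho> = lam \<bullet> \<rho> \<longrightarrow> word l lam = lam
    \<and> ((\<forall>i\<in>colors P. 0 < lam \<bullet> coroot (simple P i)) \<longrightarrow> word l = id))"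
  using assms(2)
proof (induction l rule: length_induct)
  case (1 l)
  show ?case
  proof (cases l rule: rev_cases)
    case Nil
    then show ?thesis by simp
  next
    case (snoc v j)
    then have v: "set v \<subseteq> colors P" "j \<in> colors P" "length v < length l"
      using 1 by auto
    have l: "word l = word v \<circ> refl j" by (simp add: snoc word_append)
    have root: "word v (simple P j) \<in> roots P"
      using v by (intro word_root simple_root)
    show ?thesis
    proof (cases "word v (simple P j) \<bullet> \<rho> < 0")
      case True
      then obtain l' where "set l' \<subseteq> colors P" "length l' < length v" "word l = word l'"
        using exchange[OF v(1,2) True] l by auto
      moreover from this have "length l' < length l" using v(3) by simp
      ultimately show ?thesis using 1 by auto
    next
      case False
      then have pos: "0 < word v (simple P j) \<bullet> \<rho>"
        using root_weyl_vector_cases[OF root] by blast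
      have lin: "linear (word v)"
        using word_in_W[OF v(1)] by (intro orthogonal_transformation_linear weyl_group_orthogonal)
      define c where "c = lam \<bullet> coroot (simple P j)"
      have eq: "word l lam = word v lam - c *\<^sub>R word v (simple P j)"
        by (simp add: l root_reflection_def c_def linear_diff[OF lin] linear_cmul[OF lin])
      have c: "0 \<le> c" using assms(1) v(2) by (simp add: c_def)
      have IH: "word v lam \<bullet> \<rho> \<le> lam \<bullet> \<rho>" "word v lam \<bullet> \<rho> = lam \<bullet> \<rho> \<Longrightarrow> word v lam = lam"
        using 1 v by blast+
      have prod: "0 \<le> c * (word v (simple P j) \<bullet> \<rho>)" using c pos by simp
      have le: "word l lam \<bullet> \<rho> \<le> lam \<bullet> \<rho>"
        using IH(1) prod by (simp add: eq inner_diff_left)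
      \<comment> \<open>Equality leaves no room for the subtracted term, so \<open>c = 0\<close>.
        Strict dominance of \<open>lam\<close> excludes this, which settles the clause on
        \<open>word l = id\<close>.\<close>
      moreover have "c = 0 \<and> word l lam = lam" if "word l lam \<bullet> \<rho> = lam \<bullet> \<rho>"
      proof -
        have "c * (word v (simple P j) \<bullet> \<rho>) = 0" "word v lam \<bullet> \<rho> = lam \<bullet> \<rho>"
          using that IH(1) prod unfolding eq inner_diff_left inner_scaleR_left by linarith+
        then show ?thesis using pos IH(2) by (simp add: eq)
      qed
      ultimately show ?thesis using v(2) by (force simp: c_def)
    qed
  qed
qed

lemma dominant_orbit:
  assumes "\<And>i. i \<in> colors P \<Longrightarrow> 0 \<le> lam \<bullet> coroot (simple P i)" "w \<in> W" "w lam \<noteq> lam"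
  shows "w lam \<bullet> \<rho> < lam \<bullet> \<rho>"
proof -
  obtain l where l: "set l \<subseteq> colors P" "w = word l" using W_word[OF assms(2)] by blast
  show ?thesis
    using dominant_orbit_word[of lam, OF _ l(1)] assms(1,3) unfolding l(2)
    by (meson less_eq_real_def)
qed

text \<open>\<open>\<rho>\<close> is strictly dominant, so its stabilizer is trivial and the pairing
  drops strictly away from the identity.\<close>

lemma weyl_vector_orbit:
  assumes "w \<in> W" "w \<noteq> id"
  shows "w \<rho> \<bullet> \<rho> < \<rho> \<bullet> \<rho>"
proof -
  obtain l where l: "set l \<subseteq> colors P" "w = word l" using W_word[OF assms(1)] by blast
  have "0 < \<rho> \<bullet> coroot (simple P i)" if "i \<in> colors P" for i
    using that by (simp add: weyl_vector_coroot)
  then show ?thesis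
    using dominant_orbit_word[of \<rho>, OF _ l(1)] assms(2) unfolding l(2)
    by (meson less_eq_real_def)
qed

end

section \<open>Alternants and bialternants\<close>

lemma lookup_single_times:
  fixes d :: "'a::ab_group_add \<Rightarrow>\<^sub>0 int"
  shows "Poly_Mapping.lookup (Poly_Mapping.single k c * d) x = c * Poly_Mapping.lookup d (x - k)"
proof -
  have eq: "x = k + q \<longleftrightarrow> q = x - k" for q by (auto simp: algebra_simps)
  show ?thesis
    by (simp add: lookup_mult lookup_single when_mult eq)
qed

text \<open>The integer coefficients have no 2-torsion; this turns antisymmetry into
  vanishing.\<close>

lemma poly_mapping_eq_uminus_self:
  fixes a :: "'a \<Rightarrow>\<^sub>0 int"
  assumes "a = - a"
  shows "a = 0"
proof (rule poly_mapping_eqI)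
  fix k
  have "Poly_Mapping.lookup a k = - Poly_Mapping.lookup a k"
    by (subst assms) simp
  then show "Poly_Mapping.lookup a k = Poly_Mapping.lookup 0 k" by simp
qed

context based_roots
begin

lemma W_linear: "w \<in> W \<Longrightarrow> linear w"
  by (intro orthogonal_transformation_linear weyl_group_orthogonal)

lemma W_norm: "w \<in> W \<Longrightarrow> norm (w v) = norm v"
  using orthogonal_transformation_norm weyl_group_orthogonal by blast

text \<open>Right multiplication by \<open>refl i\<close> permutes the Weyl group and negates each
  determinant.\<close>

lemma alternant_refl:
  assumes i: "i \<in> colors P"
  shows "alternant P (refl i \<mu>) = - alternant P \<mu>"
proof -
  let ?d = "\<lambda>w :: real^'n \<Rightarrow> real^'n. \<lfloor>det (matrix w)\<rfloor>"
  have rW: "w \<circ> refl i \<in> W" if "w \<in> W" for w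
    using that i by (intro weyl_group_comp root_reflection_in_weyl_group simple_root)
  have bij: "bij_betw (\<lambda>w. w \<circ> refl i) W W"
    by (rule bij_betw_byWitness[where f' = "\<lambda>w. w \<circ> refl i"])
      (auto simp: comp_assoc rW)
  have sgn: "?d (w \<circ> refl i) = - ?d w" if "w \<in> W" for w
  proof -
    have "det (matrix (w \<circ> refl i)) = - det (matrix w)"
      using that i by (simp add: det_matrix_compose W_linear linear_root_reflection
          det_root_reflection simple_nonzero)
    \<comment> \<open>Floor does not commute with negation in general; the determinant being 1 or
      -1, both values are checked.\<close>
    moreover have floor: "\<lfloor>- 1 :: real\<rfloor> = - 1"
      by (simp add: floor_eq_iff)
    ultimately show ?thesis
      using det_orthogonal_transformation[OF weyl_group_orthogonal[OF that]]
      by (auto simp: floor)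
  qed
  have "alternant P \<mu> = (\<Sum>w\<in>W. Poly_Mapping.single ((w \<circ> refl i) \<mu>) (?d (w \<circ> refl i)))"
    unfolding alternant_def by (rule sum.reindex_bij_betw[OF bij, symmetric])
  also have "\<dots> = (\<Sum>w\<in>W. - Poly_Mapping.single (w (refl i \<mu>)) (?d w))"
    by (rule sum.cong) (simp_all only: sgn comp_apply single_uminus)
  finally show ?thesis
    by (simp add: alternant_def sum_negf)
qed

lemma alternant_W:
  assumes "w \<in> W"
  shows "alternant P (w \<mu>) = alternant P \<mu> \<or> alternant P (w \<mu>) = - alternant P \<mu>"
  using assms
proof (induction rule: W_induct)
  case id
  then show ?case by simp
next
  case (refl i v)
  then show ?case by (auto simp: alternant_refl)
qed

text \<open>Invariance is stated by bijections of the index set because \<open>f\<close> may repeat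
  values. In the summand of \<open>w\<close> the exponents \<open>f x\<close> may then be replaced
  by \<open>w (f x)\<close>, which linearity merges with \<open>w \<sigma>\<close>.\<close>

lemma alternant_times_invariant_sum:
  assumes inv: "\<And>i. i \<in> colors P \<Longrightarrow> \<exists>\<phi>. bij_betw \<phi> X X \<and> (\<forall>x\<in>X. f (\<phi> x) = refl i (f x))"
  shows "alternant P \<sigma> * (\<Sum>x\<in>X. expo (f x)) = (\<Sum>x\<in>X. alternant P (\<sigma> + f x))"
proof -
  have ex: "\<exists>\<phi>. bij_betw \<phi> X X \<and> (\<forall>x\<in>X. f (\<phi> x) = w (f x))" if "w \<in> W" for w
    using that
  proof (induction rule: W_induct)
    case id
    show ?case by (intro exI[of _ id] conjI bij_betw_id) simp
  next
    case (refl i v)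
    then obtain \<phi> where \<phi>: "bij_betw \<phi> X X" "\<forall>x\<in>X. f (\<phi> x) = v (f x)" by blast
    obtain \<psi> where \<psi>: "bij_betw \<psi> X X" "\<forall>x\<in>X. f (\<psi> x) = refl i (f x)"
      using inv refl by blast
    have "\<forall>x\<in>X. f ((\<psi> \<circ> \<phi>) x) = (local.refl i \<circ> v) (f x)"
      using \<phi> \<psi>(2) by (auto simp: bij_betw_apply)
    then show ?case using bij_betw_trans[OF \<phi>(1) \<psi>(1)] by blast
  qed
  have sum: "(\<Sum>x\<in>X. expo (f x)) = (\<Sum>x\<in>X. expo (w (f x)))" if w: "w \<in> W" for w
  proof -
    obtain \<phi> where \<phi>: "bij_betw \<phi> X X" "\<forall>x\<in>X. f (\<phi> x) = w (f x)" using ex[OF w] by blast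
    have "(\<Sum>x\<in>X. expo (f x)) = (\<Sum>x\<in>X. expo (f (\<phi> x)))"
      by (rule sum.reindex_bij_betw[OF \<phi>(1), symmetric])
    then show ?thesis using \<phi>(2) by (simp cong: sum.cong)
  qed
  let ?c = "\<lambda>w :: real^'n \<Rightarrow> real^'n. \<lfloor>det (matrix w)\<rfloor>"
  have "alternant P \<sigma> * (\<Sum>x\<in>X. expo (f x))
      = (\<Sum>w\<in>W. Poly_Mapping.single (w \<sigma>) (?c w) * (\<Sum>x\<in>X. expo (w (f x))))"
    unfolding alternant_def sum_distrib_right by (rule sum.cong) (auto simp: sum)
  also have "\<dots> = (\<Sum>w\<in>W. \<Sum>x\<in>X. Poly_Mapping.single (w (\<sigma> + f x)) (?c w))"
    unfolding sum_distrib_left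
    by (intro sum.cong) (auto simp: mult_single linear_add W_linear)
  also have "\<dots> = (\<Sum>x\<in>X. alternant P (\<sigma> + f x))"
    unfolding alternant_def by (rule sum.swap)
  finally show ?thesis .
qed

text \<open>Among the exponents of the product, the largest inner product with \<open>\<rho>\<close> is attained only
  at \<open>\<rho> + \<mu>\<close>, by the identity of \<open>W\<close> and a key \<open>\<mu>\<close> of \<open>d\<close> maximal in the same sense.\<close>

lemma alternant_weyl_vector_cancel:
  assumes "alternant P \<rho> * d = 0"
  shows "d = 0"
proof (rule ccontr)
  assume "d \<noteq> 0"
  then have "(\<lambda>\<mu>. \<mu> \<bullet> \<rho>) ` Poly_Mapping.keys d \<noteq> {}" by simp
  from Max_in[OF _ this] obtain \<mu> where \<mu>: "\<mu> \<in> Poly_Mapping.keys d"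
    "\<mu> \<bullet> \<rho> = Max ((\<lambda>\<mu>. \<mu> \<bullet> \<rho>) ` Poly_Mapping.keys d)"
    by auto
  have max: "\<mu>' \<bullet> \<rho> \<le> \<mu> \<bullet> \<rho>" if "\<mu>' \<in> Poly_Mapping.keys d" for \<mu>'
    unfolding \<mu>(2) using that by (intro Max_ge) auto
  have zero: "Poly_Mapping.lookup d (\<rho> + \<mu> - w \<rho>) = 0" if "w \<in> W" "w \<noteq> id" for w
  proof (rule ccontr)
    assume "Poly_Mapping.lookup d (\<rho> + \<mu> - w \<rho>) \<noteq> 0"
    then have "(\<rho> + \<mu> - w \<rho>) \<bullet> \<rho> \<le> \<mu> \<bullet> \<rho>"
      by (intro max) (simp add: in_keys_iff)
    then show False
      using weyl_vector_orbit[OF that] by (simp add: inner_add_left inner_diff_left)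
  qed
  have "0 = Poly_Mapping.lookup (alternant P \<rho> * d) (\<rho> + \<mu>)"
    by (simp add: assms)
  also have "\<dots> = (\<Sum>w\<in>W. \<lfloor>det (matrix w)\<rfloor> * Poly_Mapping.lookup d (\<rho> + \<mu> - w \<rho>))"
    by (simp add: alternant_def sum_distrib_right lookup_sum lookup_single_times)
  also have "\<dots> = (\<Sum>w\<in>W. if w = id then Poly_Mapping.lookup d \<mu> else 0)"
    by (rule sum.cong) (auto simp: zero matrix_id_mat_1[unfolded id_def[symmetric]])
  also have "\<dots> = Poly_Mapping.lookup d \<mu>"
    using finite_W weyl_group.weyl_id[of "roots P"] by simp
  finally show False using \<mu>(1) by (simp add: in_keys_iff)
qed

section \<open>The weight lattice\<close>

lemma weight_lattice_iff:
  "v \<in> weight_lattice P \<longleftrightarrow>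
     v \<in> span (simple P ` colors P) \<and> (\<forall>k\<in>colors P. v \<bullet> coroot (simple P k) \<in> \<int>)"
proof (intro iffI conjI ballI)
  assume "v \<in> weight_lattice P"
  then obtain m :: "'i \<Rightarrow> int" where m: "v = (\<Sum>i\<in>colors P. of_int (m i) *\<^sub>R fund_weight P i)"
    by (auto simp: weight_lattice_def)
  show "v \<in> span (simple P ` colors P)" unfolding m by (rule weight_comb_span)
  show "v \<bullet> coroot (simple P k) \<in> \<int>" if "k \<in> colors P" for k
    using that unfolding m by (simp add: weight_comb_coroot)
next
  assume v: "v \<in> span (simple P ` colors P) \<and> (\<forall>k\<in>colors P. v \<bullet> coroot (simple P k) \<in> \<int>)"
  \<comment> \<open>By duality the coordinates are the pairings with the simple coroots; these are
    integral, so the floor changes only the type.\<close>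
  define m where "m i = \<lfloor>v \<bullet> coroot (simple P i)\<rfloor>" for i
  have "v = (\<Sum>i\<in>colors P. (v \<bullet> coroot (simple P i)) *\<^sub>R fund_weight P i)"
    using v span_weight_comb by blast
  also have "\<dots> = (\<Sum>i\<in>colors P. of_int (m i) *\<^sub>R fund_weight P i)"
    using v by (intro sum.cong) (auto simp: m_def elim!: Ints_cases)
  finally show "v \<in> weight_lattice P"
    by (auto simp: weight_lattice_def)
qed

lemma dominant_weightsI:
  assumes "v \<in> weight_lattice P" "\<And>k. k \<in> colors P \<Longrightarrow> 0 \<le> v \<bullet> coroot (simple P k)"
  shows "v \<in> dominant_weights P"
proof -
  define m where "m i = nat \<lfloor>v \<bullet> coroot (simple P i)\<rfloor>" for i
  have "v = (\<Sum>i\<in>colors P. (v \<bullet> coroot (simple P i)) *\<^sub>R fund_weight P i)"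
    using assms(1) weight_lattice_iff span_weight_comb by blast
  also have "\<dots> = (\<Sum>i\<in>colors P. of_nat (m i) *\<^sub>R fund_weight P i)"
  proof (rule sum.cong)
    fix k assume k: "k \<in> colors P"
    then obtain z where "v \<bullet> coroot (simple P k) = of_int z"
      using assms(1) weight_lattice_iff by (meson Ints_cases)
    then show "(v \<bullet> coroot (simple P k)) *\<^sub>R fund_weight P k = of_nat (m k) *\<^sub>R fund_weight P k"
      using assms(2)[OF k] by (simp add: m_def)
  qed simp
  finally show ?thesis
    by (auto simp: dominant_weights_def)
qed

lemma weight_lattice_add:
  "u \<in> weight_lattice P \<Longrightarrow> v \<in> weight_lattice P \<Longrightarrow> u + v \<in> weight_lattice P"
  by (auto simp: weight_lattice_iff inner_add_left intro: span_add)

lemma weight_lattice_diff: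
  "u \<in> weight_lattice P \<Longrightarrow> v \<in> weight_lattice P \<Longrightarrow> u - v \<in> weight_lattice P"
  by (auto simp: weight_lattice_iff inner_diff_left intro: span_diff)

lemma weyl_vector_in_lattice: "\<rho> \<in> weight_lattice P"
  by (simp add: weight_lattice_iff weyl_vector_span weyl_vector_coroot)

text \<open>A simple reflection subtracts an integral multiple of a simple root, whose own
  coordinates are integers.\<close>

lemma weight_lattice_W:
  assumes "w \<in> W" "v \<in> weight_lattice P"
  shows "w v \<in> weight_lattice P"
  using assms(1)
proof (induction rule: W_induct)
  case id
  then show ?case using assms(2) by simp
next
  case (refl i u)
  have int: "simple P i \<bullet> coroot (simple P k) \<in> \<int>" if "k \<in> colors P" for k
    using refl(1) that by (intro root_integral simple_root)
  have u: "u v \<in> span (simple P ` colors P)" "\<And>k. k \<in> colors P \<Longrightarrow> u v \<bullet> coroot (simple P k) \<in> \<int>"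
    using refl(3) by (simp_all add: weight_lattice_iff)
  have "(local.refl i \<circ> u) v = u v - (u v \<bullet> coroot (simple P i)) *\<^sub>R simple P i"
    by (simp add: root_reflection_def)
  moreover have "\<dots> \<in> span (simple P ` colors P)"
    using u(1) refl(1) by (intro span_diff span_scale) (auto intro: span_base)
  moreover have "(u v - (u v \<bullet> coroot (simple P i)) *\<^sub>R simple P i) \<bullet> coroot (simple P k) \<in> \<int>"
    if "k \<in> colors P" for k
    using u(2) int that refl(1) by (simp add: inner_diff_left)
  ultimately show ?case by (simp add: weight_lattice_iff)
qed

text \<open>Cauchy-Schwarz bounds the integral coordinates, and these determine the weight. This
  makes induction on the norm possible.\<close>

lemma finite_weight_lattice_ball: "finite {v \<in> weight_lattice P. norm v < r}"
proof (rule finite_imageD)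
  let ?g = "\<lambda>v. restrict (\<lambda>k. v \<bullet> coroot (simple P k)) (colors P)"
  let ?B = "\<lambda>k. r * norm (coroot (simple P k))"
  let ?S = "{v \<in> weight_lattice P. norm v < r}"
  show "finite (?g ` ?S)"
  proof (rule finite_subset)
    show "?g ` ?S \<subseteq> (\<Pi>\<^sub>E k\<in>colors P. {x \<in> \<int>. - ?B k \<le> x \<and> x \<le> ?B k})"
    proof (clarify, rule restrict_PiE_iff[THEN iffD2], intro ballI)
      fix v k assume v: "v \<in> weight_lattice P" "norm v < r" and k: "k \<in> colors P"
      have "\<bar>v \<bullet> coroot (simple P k)\<bar> \<le> norm v * norm (coroot (simple P k))"
        by (rule Cauchy_Schwarz_ineq2)
      also have "\<dots> \<le> ?B k" using v by (intro mult_right_mono) auto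
      finally show "v \<bullet> coroot (simple P k) \<in> {x \<in> \<int>. - ?B k \<le> x \<and> x \<le> ?B k}"
        using v(1) k by (auto simp: weight_lattice_iff)
    qed
    show "finite (\<Pi>\<^sub>E k\<in>colors P. {x \<in> \<int>. - ?B k \<le> x \<and> x \<le> ?B k})"
      using finite_I finite_int_segment by (intro finite_PiE) auto
  qed
  show "inj_on ?g ?S"
  proof (rule inj_onI)
    fix u v assume uv: "u \<in> ?S" "v \<in> ?S" "?g u = ?g v"
    show "u = v"
    proof (rule span_eqI)
      show "u \<bullet> coroot (simple P k) = v \<bullet> coroot (simple P k)" if "k \<in> colors P" for k
        using fun_cong[OF uv(3), of k] that by simp
    qed (use uv in \<open>auto simp: weight_lattice_iff\<close>)
  qed
qed

section \<open>Existence and uniqueness of the bialternants\<close>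

text \<open>For a strictly dominant \<open>\<sigma>\<close>, multiplying the alternant of \<open>\<rho>\<close> by the orbit sum of
  \<open>\<sigma> - \<rho>\<close> gives the alternant of \<open>\<sigma>\<close> plus alternants of shorter vectors.\<close>

lemma alternant_divisible:
  assumes "\<sigma> \<in> weight_lattice P"
  shows "\<exists>ch. Poly_Mapping.keys ch \<subseteq> weight_lattice P \<and> alternant P \<rho> * ch = alternant P \<sigma>"
  using assms
proof (induction "card {\<tau> \<in> weight_lattice P. norm \<tau> < norm \<sigma>}" arbitrary: \<sigma> rule: less_induct)
  case less
  \<comment> \<open>Alternants along an orbit agree up to sign, so it suffices to divide the one of
    a dominant conjugate.\<close>
  obtain w where w: "w \<in> W" "\<And>i. i \<in> colors P \<Longrightarrow> 0 \<le> w \<sigma> \<bullet> coroot (simple P i)"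
    using exists_dominant_conjugate by blast
  have lat: "w \<sigma> \<in> weight_lattice P"
    using weight_lattice_W w(1) less.prems by blast
  have "\<exists>ch. Poly_Mapping.keys ch \<subseteq> weight_lattice P \<and> alternant P \<rho> * ch = alternant P (w \<sigma>)"
  proof (cases "\<exists>i\<in>colors P. w \<sigma> \<bullet> coroot (simple P i) = 0")
    case True
    then obtain i where i: "i \<in> colors P" "w \<sigma> \<bullet> coroot (simple P i) = 0" by blast
    \<comment> \<open>On a reflecting wall the alternant equals its own negative.\<close>
    then have "refl i (w \<sigma>) = w \<sigma>" by (simp add: root_reflection_def)
    then have "alternant P (w \<sigma>) = 0"
      using alternant_refl[OF i(1), of "w \<sigma>"] by (intro poly_mapping_eq_uminus_self) simp
    then show ?thesis by (intro exI[of _ 0]) simp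
  next
    case False
    define lam where "lam = w \<sigma> - \<rho>"
    have lam_lat: "lam \<in> weight_lattice P"
      unfolding lam_def using lat weyl_vector_in_lattice by (rule weight_lattice_diff)
    \<comment> \<open>The coordinates of \<open>w \<sigma>\<close> are positive integers, hence at
      least 1, the coordinates of \<open>\<rho>\<close>.\<close>
    have dom: "0 \<le> lam \<bullet> coroot (simple P i)" if i: "i \<in> colors P" for i
    proof -
      obtain z where "w \<sigma> \<bullet> coroot (simple P i) = of_int z"
        using lat i weight_lattice_iff by (meson Ints_cases)
      then show ?thesis
        using w(2)[OF i] False i by (force simp: lam_def inner_diff_left weyl_vector_coroot)
    qed
    define X where "X = (\<lambda>u. u lam) ` W"
    have X_lat: "x \<in> weight_lattice P" if "x \<in> X" for x
      using that weight_lattice_W lam_lat by (auto simp: X_def)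
    have finX: "finite X" using finite_W by (simp add: X_def)
    have lamX: "lam \<in> X"
      unfolding X_def using weyl_group.weyl_id by (rule rev_image_eqI) simp
    have reflX: "refl i x \<in> X" if "i \<in> colors P" "x \<in> X" for i x
    proof -
      obtain u where "u \<in> W" "x = u lam" using \<open>x \<in> X\<close> by (auto simp: X_def)
      then show ?thesis
        using that(1) unfolding X_def
        by (intro rev_image_eqI[of "refl i \<circ> u"]) (auto intro: weyl_group.intros simple_root)
    qed
    have "alternant P \<rho> * (\<Sum>x\<in>X. expo x) = (\<Sum>x\<in>X. alternant P (\<rho> + x))"
    proof (rule alternant_times_invariant_sum)
      fix i assume i: "i \<in> colors P"
      have "bij_betw (refl i) X X"
        using reflX[OF i] by (intro bij_betw_byWitness[where f' = "refl i"]) auto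
      then show "\<exists>\<phi>. bij_betw \<phi> X X \<and> (\<forall>x\<in>X. \<phi> x = refl i x)" by blast
    qed
    also have "\<dots> = alternant P (w \<sigma>) + (\<Sum>x\<in>X - {lam}. alternant P (\<rho> + x))"
      using sum.remove[OF finX lamX, of "\<lambda>x. alternant P (\<rho> + x)"] by (simp add: lam_def)
    finally have prod: "alternant P \<rho> * (\<Sum>x\<in>X. expo x)
      = alternant P (w \<sigma>) + (\<Sum>x\<in>X - {lam}. alternant P (\<rho> + x))" .
    have "\<exists>ch. Poly_Mapping.keys ch \<subseteq> weight_lattice P \<and> alternant P \<rho> * ch = alternant P (\<rho> + x)"
      if x: "x \<in> X - {lam}" for x
    proof -
      obtain u where u: "u \<in> W" "x = u lam" using x by (auto simp: X_def)
      have "x \<bullet> \<rho> < lam \<bullet> \<rho>"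
        using dominant_orbit[OF dom u(1)] x by (simp add: u(2))
      moreover have "x \<bullet> x = lam \<bullet> lam"
        using W_norm[OF u(1), of lam] by (simp add: u(2) norm_eq)
      \<comment> \<open>The vectors \<open>x\<close> and \<open>lam\<close> have equal length, so
        the squared norms differ only in the cross term with \<open>\<rho>\<close>.\<close>
      ultimately have "norm (\<rho> + x) < norm (\<rho> + lam)"
        by (simp add: norm_lt inner_add_left inner_add_right inner_commute[of \<rho> x]
            inner_commute[of \<rho> lam])
      also have "\<dots> = norm \<sigma>"
        using W_norm[OF w(1)] by (simp add: lam_def)
      finally have lt: "norm (\<rho> + x) < norm \<sigma>" .
      have x_lat: "\<rho> + x \<in> weight_lattice P"
        using x X_lat by (intro weight_lattice_add weyl_vector_in_lattice) auto
      have "card {\<tau> \<in> weight_lattice P. norm \<tau> < norm (\<rho> + x)}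
          < card {\<tau> \<in> weight_lattice P. norm \<tau> < norm \<sigma>}"
        using lt x_lat by (intro psubset_card_mono finite_weight_lattice_ball) auto
      then show ?thesis using less.hyps x_lat by blast
    qed
    then obtain c where c: "\<And>x. x \<in> X - {lam} \<Longrightarrow> Poly_Mapping.keys (c x) \<subseteq> weight_lattice P"
      "\<And>x. x \<in> X - {lam} \<Longrightarrow> alternant P \<rho> * c x = alternant P (\<rho> + x)"
      by metis
    \<comment> \<open>The orbit sum, corrected by the quotients that the induction hypothesis gives
      for the shorter vectors.\<close>
    let ?ch = "(\<Sum>x\<in>X. expo x) - (\<Sum>x\<in>X - {lam}. c x)"
    have "alternant P \<rho> * ?ch = alternant P (w \<sigma>)"
    proof -
      have "alternant P \<rho> * (\<Sum>x\<in>X - {lam}. c x) = (\<Sum>x\<in>X - {lam}. alternant P (\<rho> + x))"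
        unfolding sum_distrib_left using c(2) by (rule sum.cong[OF refl])
      then show ?thesis unfolding right_diff_distrib prod by simp
    qed
    moreover have "Poly_Mapping.keys ?ch \<subseteq> weight_lattice P"
    proof -
      have "Poly_Mapping.keys (\<Sum>x\<in>X. expo x) \<subseteq> weight_lattice P"
        using X_lat keys_sum[of expo X] by fastforce
      moreover have "Poly_Mapping.keys (\<Sum>x\<in>X - {lam}. c x) \<subseteq> weight_lattice P"
        using c(1) keys_sum[of c "X - {lam}"] by fastforce
      ultimately show ?thesis
        using keys_diff[of "\<Sum>x\<in>X. expo x" "\<Sum>x\<in>X - {lam}. c x"] by (meson Un_least order_trans)
    qed
    ultimately show ?thesis by blast
  qed
  then obtain ch where ch: "Poly_Mapping.keys ch \<subseteq> weight_lattice P"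
    "alternant P \<rho> * ch = alternant P (w \<sigma>)" by blast
  show ?case
    using alternant_W[OF w(1), of \<sigma>]
  proof
    assume "alternant P (w \<sigma>) = alternant P \<sigma>"
    then show ?thesis using ch by metis
  next
    assume "alternant P (w \<sigma>) = - alternant P \<sigma>"
    then show ?thesis using ch by (intro exI[of _ "- ch"]) simp
  qed
qed

text \<open>Justifies the \<open>THE\<close> in \<open>bialternant\<close>: divisibility gives
  existence, cancellation gives uniqueness.\<close>

lemma alternant_times_bialternant:
  assumes "lam \<in> weight_lattice P"
  shows "alternant P \<rho> * bialternant P lam = alternant P (lam + \<rho>)"
proof -
  let ?Q = "\<lambda>ch. Poly_Mapping.keys ch \<subseteq> weight_lattice P
    \<and> alternant P \<rho> * ch = alternant P (lam + \<rho>)"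
  have "\<exists>!ch. ?Q ch"
  proof (rule ex_ex1I)
    show "\<exists>ch. ?Q ch"
      using assms weyl_vector_in_lattice by (intro alternant_divisible weight_lattice_add)
  next
    fix c c' assume "?Q c" "?Q c'"
    then have "alternant P \<rho> * (c - c') = 0" by (simp add: right_diff_distrib)
    then show "c = c'" using alternant_weyl_vector_cancel by fastforce
  qed
  from theI'[OF this] show ?thesis by (simp add: bialternant_def)
qed

end

section \<open>Passage to the subsystem of \<open>J\<close>\<close>

lemma based_root_subsystem:
  fixes P :: "(real^'n, 'i) root_datum"
  assumes "based_root_system P" "J \<subseteq> colors P"
  shows "based_root_system (root_subsystem P J)"
proof -
  interpret based_roots P by (unfold_locales) (rule assms(1))
  let ?S = "span (simple P ` J)"
  let ?R = "roots P \<inter> ?S"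
  have finJ: "finite J" using finite_I assms(2) finite_subset by blast
  have ind: "independent (simple P ` colors P)" and inj: "inj_on (simple P) (colors P)"
    and mult: "\<And>a c. a \<in> roots P \<Longrightarrow> c *\<^sub>R a \<in> roots P \<Longrightarrow> c = 1 \<or> c = - 1"
    using assms(1) by (auto simp: based_root_system_def root_system_def)
  have refl: "root_reflection a b \<in> ?R" if "a \<in> ?R" "b \<in> ?R" for a b
  proof -
    have "root_reflection a b \<in> ?S"
      using that unfolding root_reflection_def by (intro span_diff span_scale) auto
    then show ?thesis using that reflection_root by blast
  qed
  have "root_reflection a ` ?R = ?R" if "a \<in> ?R" for a
  proof
    show "root_reflection a ` ?R \<subseteq> ?R" using refl that by blast
    show "?R \<subseteq> root_reflection a ` ?R"
    proof
      fix b assume "b \<in> ?R"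
      then show "b \<in> root_reflection a ` ?R"
        using refl[OF that] by (intro rev_image_eqI[of "root_reflection a b"]) auto
    qed
  qed
  then have root_system: "root_system ?R"
    using finite_roots root_nonzero root_integral mult
    unfolding root_system_def by blast
  \<comment> \<open>A root in the span of the simple roots of \<open>J\<close> also has a real
    expansion over \<open>J\<close>; uniqueness makes its integer coefficients outside
    \<open>J\<close> vanish.\<close>
  have comb: "\<exists>c :: 'i \<Rightarrow> int. b = (\<Sum>i\<in>J. of_int (c i) *\<^sub>R simple P i)
           \<and> ((\<forall>i\<in>J. 0 \<le> c i) \<or> (\<forall>i\<in>J. c i \<le> 0))" if b: "b \<in> ?R" for b
  proof -
    obtain c :: "'i \<Rightarrow> int" where c: "b = (\<Sum>i\<in>colors P. of_int (c i) *\<^sub>R simple P i)"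
      "(\<forall>i\<in>colors P. 0 \<le> c i) \<or> (\<forall>i\<in>colors P. c i \<le> 0)"
      using root_expansion b by blast
    obtain d where d: "b = (\<Sum>v\<in>simple P ` J. d v *\<^sub>R v)"
      using b finJ by (auto simp: span_finite)
    have "b = (\<Sum>i\<in>J. d (simple P i) *\<^sub>R simple P i)"
      unfolding d using inj_on_subset[OF inj assms(2)] by (simp add: sum.reindex)
    also have "\<dots> = (\<Sum>i\<in>colors P. (if i \<in> J then d (simple P i) else 0) *\<^sub>R simple P i)"
      using assms(2) finite_I by (intro sum.mono_neutral_cong_left) auto
    finally have "(\<Sum>i\<in>colors P. of_int (c i) *\<^sub>R simple P i)
      = (\<Sum>i\<in>colors P. (if i \<in> J then d (simple P i) else 0) *\<^sub>R simple P i)"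
      using c(1) by simp
    from simple_comb_unique[OF this] have "c i = 0" if "i \<in> colors P - J" for i
      using that by force
    then have "b = (\<Sum>i\<in>J. of_int (c i) *\<^sub>R simple P i)"
      unfolding c(1) using assms(2) finite_I by (intro sum.mono_neutral_right) auto
    then show ?thesis using c(2) assms(2) by blast
  qed
  show ?thesis
    unfolding based_root_system_def
    using root_system comb inj_on_subset[OF inj assms(2)] simple_root assms(2)
      independent_mono[OF ind image_mono[OF assms(2)]]
    by (auto simp: root_subsystem_def intro: span_base)
qed

text \<open>Several elements may share a weight or a restricted weight. Additivity of
  \<open>restrict_char\<close> allows restricting one element at a time.\<close>

lemma restrict_char_WGF:
  fixes P :: "(real^'n, 'i) root_datum"
  assumes "based_root_system P" "J \<subseteq> colors P" "finite (elems R)"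
  shows "restrict_char P J (WGF P R) = (\<Sum>x\<in>elems R. expo (wt (root_subsystem P J) R x))"
proof -
  have add: "restrict_char P J (a + b) = restrict_char P J a + restrict_char P J b" for a b
    unfolding restrict_char_def by (rule setsum_keys_plus_distrib) (simp_all add: single_add)
  have single: "restrict_char P J (expo \<mu>) = expo (restrict_weight P J \<mu>)" for \<mu>
    by (simp add: restrict_char_def)
  have "restrict_char P J (\<Sum>x\<in>X. expo (wt P R x)) = (\<Sum>x\<in>X. expo (restrict_weight P J (wt P R x)))"
    if "finite X" for X
    using that
    by (induction X) (simp_all add: add single, simp add: restrict_char_def)
  moreover have "restrict_weight P J (wt P R x) = wt (root_subsystem P J) R x" for x
    unfolding wt_def using restrict_weight_sum[OF assms(1,2)] by (simp add: root_subsystem_def)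
  ultimately show ?thesis
    using assms(3) by (simp add: WGF_def)
qed

section \<open>Fibrous structured posets\<close>

lemma color_edges_elems: "(s, t) \<in> color_edges R i \<Longrightarrow> s \<in> elems R \<and> t \<in> elems R"
  by (auto simp: color_edges_def hasse_edges_def)

lemma color_comp_self: "x \<in> elems R \<Longrightarrow> x \<in> color_comp R i x"
  by (simp add: color_comp_def)

lemma color_comp_eq:
  assumes "y \<in> color_comp R i x"
  shows "color_comp R i y = color_comp R i x"
proof -
  let ?E = "(color_edges R i \<union> (color_edges R i)\<inverse>)\<^sup>*"
  have "sym ?E" by (intro sym_rtrancl) (auto simp: sym_def)
  moreover have "(x, y) \<in> ?E" using assms by (simp add: color_comp_def)
  ultimately have "(x, z) \<in> ?E \<longleftrightarrow> (y, z) \<in> ?E" for z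
    by (meson rtrancl_trans symD)
  then show ?thesis by (simp add: color_comp_def)
qed

lemma color_comp_induct [consumes 2, case_names base up down]:
  assumes "y \<in> color_comp R i x" "x \<in> elems R" "Q x"
    and "\<And>s t. s \<in> color_comp R i x \<Longrightarrow> t \<in> color_comp R i x \<Longrightarrow> (s, t) \<in> color_edges R i \<Longrightarrow> Q s \<Longrightarrow> Q t"
    and "\<And>s t. s \<in> color_comp R i x \<Longrightarrow> t \<in> color_comp R i x \<Longrightarrow> (s, t) \<in> color_edges R i \<Longrightarrow> Q t \<Longrightarrow> Q s"
  shows "Q y"
proof -
  have "(x, y) \<in> (color_edges R i \<union> (color_edges R i)\<inverse>)\<^sup>*"
    using assms(1) by (simp add: color_comp_def)
  then have "y \<in> color_comp R i x \<and> Q y"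
  proof (induction rule: rtrancl_induct)
    case base
    show ?case using assms(2,3) by (simp add: color_comp_self)
  next
    case (step y z)
    have "z \<in> color_comp R i x"
      using step(1,2) color_edges_elems[of _ _ R i] unfolding color_comp_def
      by (auto intro: rtrancl_into_rtrancl)
    then show ?case using step assms(4,5) by blast
  qed
  then show ?thesis by blast
qed

text \<open>The difference of two rank functions is constant along edges. Both are nonnegative and
  attain 0, so this constant is neither positive nor negative.\<close>

lemma rank_function_unique:
  assumes x: "x \<in> elems R" and y: "y \<in> color_comp R i x"
    and r: "rank_function (color_comp R i x) (color_edges R i) r l"
    and r': "rank_function (color_comp R i x) (color_edges R i) r' l'"
  shows "r y = r' y"
proof -
  have const: "int (r z) - int (r' z) = int (r x) - int (r' x)" if "z \<in> color_comp R i x" for z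
    using that x
  proof (induction rule: color_comp_induct)
    case base
    then show ?case by simp
  next
    case (up s t)
    then have "r s + 1 = r t" "r' s + 1 = r' t" using r r' by (auto simp: rank_function_def)
    then show ?case using up(4) by linarith
  next
    case (down s t)
    then have "r s + 1 = r t" "r' s + 1 = r' t" using r r' by (auto simp: rank_function_def)
    then show ?case using down(4) by linarith
  qed
  have "0 \<in> r ` color_comp R i x" "0 \<in> r' ` color_comp R i x"
    using r r' by (auto simp: rank_function_def)
  then obtain u v where "u \<in> color_comp R i x" "r u = 0" "v \<in> color_comp R i x" "r' v = 0"
    by auto
  then have "r x = r' x" using const[of u] const[of v] by simp
  then show ?thesis using const[OF y] by simp
qed

locale fibrous_structured = based_roots P
  for P :: "(real^'n, 'i) root_datum" +
  fixes R :: "('v, 'i) colored_poset"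
  assumes structured: "structured_poset P R" and fib: "fibrous P R"
begin

lemma finite_elems: "finite (elems R)"
  using structured by (simp add: structured_poset_def ranked_poset_def finite_poset_def)

text \<open>A rank function of the whole poset is shifted to start at 0 on the component. A directed
  path from the lowest to the highest element climbs one rank per edge, so no value is
  skipped.\<close>

lemma comp_rank_exists:
  assumes i: "i \<in> colors P" and x: "x \<in> elems R"
  shows "\<exists>r l. rank_function (color_comp R i x) (color_edges R i) r l"
proof -
  let ?C = "color_comp R i x" and ?E = "color_edges R i"
  obtain g l where "rank_function (elems R) (hasse_edges R) g l"
    using structured by (auto simp: structured_poset_def ranked_poset_def)
  then have g: "g s + 1 = g t" if "(s, t) \<in> ?E" for s t
    using that color_edges_elems[OF that] by (auto simp: rank_function_def color_edges_def)
  have finC: "finite (g ` ?C)" "g ` ?C \<noteq> {}"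
    using finite_elems x color_comp_self[of x R i] by (auto simp: color_comp_def)
  obtain b where b: "b \<in> ?C" "g b = Min (g ` ?C)" using Min_in[OF finC] by auto
  obtain t where t: "t \<in> ?C" "g t = Max (g ` ?C)" using Max_in[OF finC] by auto
  have lo: "g b \<le> g y" and hi: "g y \<le> g t" if "y \<in> ?C" for y
    using that finC by (auto simp: b(2) t(2))
  have mono: "u = v \<or> g u < g v" if "(u, v) \<in> ?E\<^sup>*" for u v
    using that by (induction rule: rtrancl_induct) (use g in fastforce)+
  have "(b, t) \<in> ?E\<^sup>* \<or> (t, b) \<in> ?E\<^sup>*"
    using fib i x b(1) t(1) by (auto simp: fibrous_def)
  \<comment> \<open>Edges raise \<open>g\<close>, so a path from the maximum to the minimum would
    have equal ends.\<close>
  then have bt: "(b, t) \<in> ?E\<^sup>*"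
    using mono[of t b] hi[OF b(1)] by auto
  have "\<exists>y\<in>?C. g y = k" if "g b \<le> k" "k \<le> g t" for k
    using bt that(2)
  proof (induction rule: rtrancl_induct)
    case base
    then show ?case using that(1) b(1) by (intro bexI[of _ b]) auto
  next
    case (step y z)
    show ?case
    proof (cases "k \<le> g y")
      case True
      then show ?thesis using step.IH by blast
    next
      case False
      then have "g z = k" using g[OF step.hyps(2)] step.prems by simp
      moreover have "z \<in> ?C"
      proof -
        have "(b, z) \<in> ?E\<^sup>*" using step.hyps by simp
        then have "(b, z) \<in> (?E \<union> ?E\<inverse>)\<^sup>*" using rtrancl_mono[of ?E "?E \<union> ?E\<inverse>"] by blast
        then have "z \<in> color_comp R i b"
          using color_edges_elems[OF step.hyps(2)] by (simp add: color_comp_def)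
        then show ?thesis using color_comp_eq[OF b(1)] by simp
      qed
      ultimately show ?thesis by blast
    qed
  qed
  then have ex: "\<exists>y\<in>?C. g y = g b + k" if "k \<le> g t - g b" for k
    using that hi[OF b(1)] by simp
  have "(\<lambda>y. g y - g b) ` ?C = {0..g t - g b}"
  proof
    show "(\<lambda>y. g y - g b) ` ?C \<subseteq> {0..g t - g b}"
      by (intro image_subsetI) (simp add: hi diff_le_mono)
    show "{0..g t - g b} \<subseteq> (\<lambda>y. g y - g b) ` ?C"
    proof
      fix k assume "k \<in> {0..g t - g b}"
      then obtain y where "y \<in> ?C" "g y = g b + k" using ex by auto
      then show "k \<in> (\<lambda>y. g y - g b) ` ?C" by (intro rev_image_eqI[of y]) auto
    qed
  qed
  moreover have "g u - g b + 1 = g v - g b" if "u \<in> ?C" "(u, v) \<in> ?E" for u v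
    using g[OF that(2)] lo[OF that(1)] by simp
  ultimately have "rank_function ?C ?E (\<lambda>y. g y - g b) (g t - g b)"
    by (auto simp: rank_function_def)
  then show ?thesis by blast
qed

text \<open>Existence and uniqueness give the \<open>THE\<close> descriptions their meaning.
  Elements of one component share it, so \<open>comp_rank R i\<close> serves as a single rank
  function on all of it.\<close>

lemma comp_rank_function:
  assumes i: "i \<in> colors P" and x: "x \<in> elems R"
  shows "rank_function (color_comp R i x) (color_edges R i) (comp_rank R i) (comp_length R i x)"
    and "y \<in> color_comp R i x \<Longrightarrow> comp_length R i y = comp_length R i x"
proof -
  let ?C = "color_comp R i x" and ?E = "color_edges R i"
  obtain r l where r: "rank_function ?C ?E r l"
    using comp_rank_exists[OF assms] by blast
  have rank: "comp_rank R i y = r y" if y: "y \<in> ?C" for y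
    unfolding comp_rank_def color_comp_eq[OF y]
  proof (rule the_equality)
    show "\<exists>\<rho> l. rank_function ?C ?E \<rho> l \<and> \<rho> y = r y" using r by blast
  next
    fix q assume "\<exists>\<rho> l. rank_function ?C ?E \<rho> l \<and> \<rho> y = q"
    then obtain r' l' where "rank_function ?C ?E r' l'" "r' y = q" by blast
    then show "q = r y" using rank_function_unique[OF x y r] by simp
  qed
  have len': "(THE l. \<exists>\<rho>. rank_function ?C ?E \<rho> l) = l"
  proof (rule the_equality)
    show "\<exists>\<rho>. rank_function ?C ?E \<rho> l" using r by blast
  next
    fix l' assume "\<exists>\<rho>. rank_function ?C ?E \<rho> l'"
    then obtain r' where r': "rank_function ?C ?E r' l'" by blast
    have "r' ` ?C = r ` ?C"
      using rank_function_unique[OF x _ r' r] by (intro image_cong) auto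
    then show "l' = l" using r r' by (simp add: rank_function_def)
  qed
  have len: "comp_length R i y = l" if y: "y \<in> ?C" for y
    unfolding comp_length_def color_comp_eq[OF y] by (rule len')
  show "y \<in> ?C \<Longrightarrow> comp_length R i y = comp_length R i x"
    using len color_comp_self[OF x] by simp
  have "comp_rank R i ` ?C = r ` ?C" using rank by (intro image_cong) auto
  then show "rank_function ?C ?E (comp_rank R i) (comp_length R i x)"
    using r rank len[OF color_comp_self[OF x]] by (simp add: rank_function_def)
qed

section \<open>Ranks, weights and depths along chains\<close>

lemma comp_rank_le:
  assumes "i \<in> colors P" "x \<in> elems R"
  shows "comp_rank R i x \<le> comp_length R i x"
  using comp_rank_function(1)[OF assms] color_comp_self[OF assms(2), of i]
  by (auto simp: rank_function_def)

lemma color_path_rank: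
  assumes i: "i \<in> colors P" and "y \<in> elems R" and "(y, z) \<in> (color_edges R i)\<^sup>*"
  shows "y = z \<or> comp_rank R i y < comp_rank R i z"
  using assms(3)
proof (induction rule: rtrancl_induct)
  case (step u v)
  then have uv: "u \<in> elems R" "v \<in> elems R" using color_edges_elems by metis+
  have "v \<in> color_comp R i u"
    using step(2) uv by (auto simp: color_comp_def)
  then have "comp_rank R i u + 1 = comp_rank R i v"
    using comp_rank_function(1)[OF i uv(1)] step(2) color_comp_self[OF uv(1)]
    by (auto simp: rank_function_def)
  then show ?case using step.IH by auto
qed simp

lemma color_chain:
  assumes "i \<in> colors P" "x \<in> elems R" "y \<in> color_comp R i x" "z \<in> color_comp R i x"
  shows "(y, z) \<in> (color_edges R i)\<^sup>* \<or> (z, y) \<in> (color_edges R i)\<^sup>*"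
  using fib assms by (auto simp: fibrous_def)

text \<open>Two elements of a chain are joined by a directed path, and a nontrivial path raises the
  rank.\<close>

lemma comp_rank_inj:
  assumes i: "i \<in> colors P" and x: "x \<in> elems R"
  shows "inj_on (comp_rank R i) (color_comp R i x)"
proof (rule inj_onI)
  fix y z assume yz: "y \<in> color_comp R i x" "z \<in> color_comp R i x" "comp_rank R i y = comp_rank R i z"
  then have "y \<in> elems R" "z \<in> elems R" by (auto simp: color_comp_def)
  then show "y = z"
    using color_chain[OF i x yz(1,2)] color_path_rank[OF i] yz(3) by (metis less_irrefl)
qed

lemma wt_coroot: "i \<in> colors P \<Longrightarrow> wt P R x \<bullet> coroot (simple P i) = of_int (comp_mult R i x)"
  unfolding wt_def by (rule weight_comb_coroot)

text \<open>Each edge raises the rank by one and adds one simple root.\<close>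

lemma wt_along_comp:
  assumes i: "i \<in> colors P" and x: "x \<in> elems R" and y: "y \<in> color_comp R i x"
  shows "wt P R y = wt P R x + (real (comp_rank R i y) - real (comp_rank R i x)) *\<^sub>R simple P i"
  using y x
proof (induction rule: color_comp_induct)
  case base
  then show ?case by simp
next
  case (up s t)
  have "wt P R s + simple P i = wt P R t"
    using structured i up(3) by (auto simp: structured_poset_def)
  moreover have "comp_rank R i s + 1 = comp_rank R i t"
    using comp_rank_function(1)[OF i x] up by (auto simp: rank_function_def)
  then have "real (comp_rank R i t) = real (comp_rank R i s) + 1" by linarith
  ultimately show ?case using up(4) by (simp add: algebra_simps)
next
  case (down s t)
  have "wt P R s + simple P i = wt P R t"
    using structured i down(3) by (auto simp: structured_poset_def)
  then have "wt P R s = wt P R t - simple P i" by (simp add: algebra_simps)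
  moreover have "comp_rank R i s + 1 = comp_rank R i t"
    using comp_rank_function(1)[OF i x] down by (auto simp: rank_function_def)
  then have "real (comp_rank R i t) = real (comp_rank R i s) + 1" by linarith
  ultimately show ?case using down(4) by (simp add: algebra_simps)
qed

text \<open>In a chain the elements above \<open>y\<close> are those of larger rank. Ranks are
  distinct and fill the interval up to the length, so their number is the depth of
  \<open>y\<close>.\<close>

lemma top_part_depth:
  assumes i: "i \<in> colors P" and x: "x \<in> elems R"
  shows "top_part R i x p = {y \<in> color_comp R i x. comp_depth R i y \<le> p}"
proof -
  let ?C = "color_comp R i x" and ?l = "comp_length R i x"
  have card: "card {z \<in> ?C. (y, z) \<in> (color_edges R i)\<^sup>+} = comp_depth R i y" if y: "y \<in> ?C" for y
  proof -
    have "(y, z) \<in> (color_edges R i)\<^sup>+ \<longleftrightarrow> comp_rank R i y < comp_rank R i z" if z: "z \<in> ?C" for z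
    proof -
      have el: "y \<in> elems R" "z \<in> elems R" using y z by (auto simp: color_comp_def)
      have "comp_rank R i y < comp_rank R i z" if yz: "(y, z) \<in> (color_edges R i)\<^sup>+"
      proof -
        obtain u where u: "(y, u) \<in> color_edges R i" "(u, z) \<in> (color_edges R i)\<^sup>*"
          using tranclD[OF yz] by blast
        have "u \<in> elems R" using color_edges_elems[OF u(1)] by blast
        moreover have "y \<noteq> u" using u(1) by (auto simp: color_edges_def hasse_edges_def)
        ultimately show ?thesis
          using color_path_rank[OF i el(1) r_into_rtrancl[OF u(1)]] color_path_rank[OF i _ u(2)]
          by auto
      qed
      moreover have "(y, z) \<in> (color_edges R i)\<^sup>+" if less: "comp_rank R i y < comp_rank R i z"
      proof -
        have "(z, y) \<notin> (color_edges R i)\<^sup>*"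
          using color_path_rank[OF i el(2), of y] less by fastforce
        then have "(y, z) \<in> (color_edges R i)\<^sup>*"
          using color_chain[OF i x y z] by blast
        then show ?thesis using less by (metis less_irrefl rtranclD)
      qed
      ultimately show ?thesis by blast
    qed
    then have "{z \<in> ?C. (y, z) \<in> (color_edges R i)\<^sup>+} = {z \<in> ?C. comp_rank R i y < comp_rank R i z}"
      by blast
    moreover have "card \<dots> = card (comp_rank R i ` {z \<in> ?C. comp_rank R i y < comp_rank R i z})"
      using inj_on_subset[OF comp_rank_inj[OF i x]] by (intro card_image[symmetric]) auto
    moreover have "comp_rank R i ` {z \<in> ?C. comp_rank R i y < comp_rank R i z}
        = {k \<in> comp_rank R i ` ?C. comp_rank R i y < k}" by blast
    moreover have "\<dots> = {comp_rank R i y<..?l}"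
      using comp_rank_function(1)[OF i x] by (auto simp: rank_function_def)
    ultimately show ?thesis
      using comp_rank_function(2)[OF i x y] by (simp add: comp_depth_def)
  qed
  show ?thesis
    unfolding top_part_def by (intro Collect_cong conj_cong refl) (simp only: card)
qed

section \<open>Reversal of chains\<close>

text \<open>\<open>chain_flip i p\<close> reverses each component of color \<open>i\<close> after removing its top \<open>p\<close> elements.\<close>

definition chain_flip :: "'i \<Rightarrow> nat \<Rightarrow> 'v \<Rightarrow> 'v" where
  "chain_flip i p x = (THE y. y \<in> color_comp R i x
     \<and> comp_rank R i y + comp_rank R i x + p = comp_length R i x)"

text \<open>The required rank lies in the range of the ranks and is attained once; the defining
  equation is symmetric in the two ranks, so flipping twice returns to \<open>x\<close>. Rank minus
  depth is the pairing with the coroot, which determines the change of weight.\<close>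

lemma chain_flip:
  assumes i: "i \<in> colors P" and x: "x \<in> elems R" and p: "p \<le> comp_depth R i x"
  shows "chain_flip i p x \<in> color_comp R i x" (is ?comp)
    and "chain_flip i p x \<in> elems R" (is ?elem)
    and "p \<le> comp_depth R i (chain_flip i p x)" (is ?depth)
    and "chain_flip i p (chain_flip i p x) = x" (is ?inv)
    and "wt P R (chain_flip i p x)
      = wt P R x - (wt P R x \<bullet> coroot (simple P i) + real p) *\<^sub>R simple P i" (is ?wt)
proof -
  let ?C = "color_comp R i x" and ?l = "comp_length R i x" and ?r = "comp_rank R i"
  let ?y = "chain_flip i p x"
  have le: "?r x + p \<le> ?l" using p comp_rank_le[OF i x] by (simp add: comp_depth_def)
  then have "?l - p - ?r x \<in> ?r ` ?C"
    using comp_rank_function(1)[OF i x] by (auto simp: rank_function_def)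
  then obtain y where y: "y \<in> ?C" "?r y + ?r x + p = ?l"
    using le by auto
  have uniq: "y' = y''" if "y' \<in> ?C" "y'' \<in> ?C" "?r y' = ?r y''" for y' y''
    using comp_rank_inj[OF i x] that by (meson inj_onD)
  have "?y = y"
    unfolding chain_flip_def using y by (intro the_equality) (auto intro!: uniq)
  then show ?comp and ?elem and ?depth
    using y comp_rank_function(2)[OF i x y(1)] by (auto simp: color_comp_def comp_depth_def)
  have len: "comp_length R i y = ?l" and C: "color_comp R i y = ?C"
    using comp_rank_function(2)[OF i x y(1)] color_comp_eq[OF y(1)] by auto
  have "chain_flip i p y = x"
    unfolding chain_flip_def len C using y color_comp_self[OF x]
    by (intro the_equality) (auto intro!: uniq)
  then show ?inv using \<open>?y = y\<close> by simp
  have "wt P R x \<bullet> coroot (simple P i) = real (?r x) - real (?l - ?r x)"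
    using wt_coroot[OF i] by (simp add: comp_mult_def comp_depth_def)
  also have "\<dots> = real (?r x) - (real ?l - real (?r x))"
    using le by simp
  also have "real ?l = real (?r y) + real (?r x) + real p"
    using y(2) by (metis of_nat_add)
  finally have "real (?r y) - real (?r x) = - (wt P R x \<bullet> coroot (simple P i) + real p)"
    by simp
  then show ?wt
    using wt_along_comp[OF i x y(1)] \<open>?y = y\<close> by (simp only: scaleR_minus_left) simp
qed

end

text \<open>Fundamental weights of the subsystem may differ from those of \<open>P\<close>, but
  weights in both systems have the same pairings with the coroots of \<open>J\<close>. Both sides
  lie in the span of the simple roots of \<open>J\<close>, where these pairings decide
  equality.\<close>

lemma subsystem_wt_flip:
  assumes "fibrous_structured P R" "J \<subseteq> colors P" "j \<in> J" "x \<in> elems R"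
    and p: "p \<le> comp_depth R j x"
  shows "wt (root_subsystem P J) R (fibrous_structured.chain_flip R j p x)
    = root_reflection (simple P j) (wt (root_subsystem P J) R x) - real p *\<^sub>R simple P j"
proof -
  interpret fibrous_structured P R by (rule assms(1))
  let ?Q = "root_subsystem P J"
  interpret Q: based_roots ?Q
    using based_root_subsystem[OF based assms(2)] by unfold_locales
  have Qsel: "colors ?Q = J" "simple ?Q = simple P" by (simp_all add: root_subsystem_def)
  have j: "j \<in> colors P" using assms(2,3) by blast
  have pair: "wt ?Q R y \<bullet> coroot (simple P k) = wt P R y \<bullet> coroot (simple P k)" if "k \<in> J" for y k
    using Q.weight_comb_coroot[of k "\<lambda>k. of_int (comp_mult R k y)"] wt_coroot[of k y] that assms(2)
    by (auto simp: wt_def Qsel)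
  have span: "wt ?Q R y \<in> span (simple P ` J)" for y
    using Q.weight_comb_span[of "\<lambda>k. of_int (comp_mult R k y)"] by (simp add: wt_def Qsel)
  show ?thesis
  proof (rule Q.span_eqI, unfold Qsel)
    show "root_reflection (simple P j) (wt ?Q R x) - real p *\<^sub>R simple P j \<in> span (simple P ` J)"
      unfolding root_reflection_def
      using span assms(3) by (intro span_diff span_scale) (auto intro: span_base)
  next
    fix k assume k: "k \<in> J"
    show "wt ?Q R (chain_flip j p x) \<bullet> coroot (simple P k)
      = (root_reflection (simple P j) (wt ?Q R x) - real p *\<^sub>R simple P j) \<bullet> coroot (simple P k)"
      by (simp add: pair[OF k] pair[OF assms(3)] chain_flip(5)[OF j assms(4) p]
          root_reflection_def inner_diff_left distrib_right)
  qed (rule span)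
qed

section \<open>Splitting by a coloring\<close>

theorem theorem6p3:
  fixes P :: "(real^'n, 'i) root_datum"
    and R :: "('v, 'i) colored_poset"
    and J :: "'i set" and n :: "'i \<Rightarrow> nat" and \<nu> :: "real^'n" and \<kappa> :: "'v \<Rightarrow> 'i"
  assumes "based_root_system P"
    and "structured_poset P R" and "fibrous P R"
    and "J \<subseteq> colors P"
    and "\<nu> = (\<Sum>j\<in>J. of_nat (n j) *\<^sub>R fund_weight (root_subsystem P J) j)"
    and "poset_coloring R J n \<kappa>"
  shows "splitting_poset P J \<nu> R (max_set R J n)
    \<and> bialternant (root_subsystem P J) \<nu> * restrict_char P J (WGF P R)
        = (\<Sum>m\<in>max_set R J n.
             bialternant (root_subsystem P J) (\<nu> + wt (root_subsystem P J) R m))"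
proof -
  interpret fibrous_structured P R
    using assms(1-3) by unfold_locales
  let ?Q = "root_subsystem P J"
  interpret Q: based_roots ?Q
    using based_root_subsystem[OF assms(1,4)] by unfold_locales
  have Qsel: "colors ?Q = J" "simple ?Q = simple P" by (simp_all add: root_subsystem_def)
  let ?M = "max_set R J n" and ?\<rho> = "weyl_vector ?Q" and ?wt = "wt ?Q R" and ?A = "alternant ?Q"
  define N where "N = elems R - ?M"
  have M_sub: "?M \<subseteq> elems R" by (auto simp: max_set_def)
  have fs: "fibrous_structured P R" by unfold_locales

  \<comment> \<open>Coordinates and dominance of the weights\<close>
  have \<nu>_coroot: "\<nu> \<bullet> coroot (simple P k) = real (n k)" if "k \<in> J" for k
    using Q.weight_comb_coroot[of k "\<lambda>k. of_nat (n k)"] that unfolding Qsel assms(5) by simp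
  have \<nu>_span: "\<nu> \<in> span (simple P ` J)"
    using Q.weight_comb_span[of "\<lambda>k. of_nat (n k)"] unfolding Qsel assms(5) .
  have \<nu>_lat: "\<nu> \<in> weight_lattice ?Q"
    using \<nu>_span \<nu>_coroot by (simp add: Q.weight_lattice_iff Qsel)
  have wt_lat: "?wt x \<in> weight_lattice ?Q" for x
    unfolding weight_lattice_def wt_def
    by (intro CollectI exI[of _ "\<lambda>k. comp_mult R k x"] conjI TrueI refl)
  have wt_coroot: "?wt x \<bullet> coroot (simple P k) = of_int (comp_mult R k x)" if "k \<in> J" for k x
    using Q.weight_comb_coroot[of k "\<lambda>k. of_int (comp_mult R k x)"] that
    unfolding wt_def Qsel by simp
  have \<nu>_dom: "\<nu> \<in> dominant_weights ?Q"
    using \<nu>_lat \<nu>_coroot by (intro Q.dominant_weightsI) (auto simp: Qsel)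
  have M_dom: "\<nu> + ?wt m \<in> dominant_weights ?Q" if "m \<in> ?M" for m
  proof (rule Q.dominant_weightsI)
    show "\<nu> + ?wt m \<in> weight_lattice ?Q" using \<nu>_lat wt_lat by (rule Q.weight_lattice_add)
    fix k assume "k \<in> colors ?Q"
    then have k: "k \<in> J" by (simp add: Qsel)
    then have "comp_depth R k m \<le> n k" using that by (simp add: max_set_def)
    \<comment> \<open>\<open>comp_mult\<close> is rank minus depth, and ranks are
      nonnegative.\<close>
    then have "0 \<le> int (n k) + comp_mult R k m" by (simp add: comp_mult_def)
    then have "0 \<le> real (n k) + of_int (comp_mult R k m)" by linarith
    then show "0 \<le> (\<nu> + ?wt m) \<bullet> coroot (simple ?Q k)"
      by (simp add: inner_add_left Qsel \<nu>_coroot[OF k] wt_coroot[OF k])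
  qed

  \<comment> \<open>The product as a sum of alternants over all of \<open>R\<close>\<close>
  have expand: "?A (\<nu> + ?\<rho>) * (\<Sum>x\<in>elems R. expo (?wt x)) = (\<Sum>x\<in>elems R. ?A (\<nu> + ?\<rho> + ?wt x))"
  proof (rule Q.alternant_times_invariant_sum, unfold Qsel)
    fix j assume j: "j \<in> J"
    then have jP: "j \<in> colors P" using assms(4) by blast
    \<comment> \<open>With \<open>p = 0\<close> nothing is cut off, so every element may be flipped
      and the flip is its own inverse.\<close>
    have "bij_betw (chain_flip j 0) (elems R) (elems R)"
      using chain_flip(2,4)[OF jP] by (intro bij_betw_byWitness[where f' = "chain_flip j 0"]) auto
    moreover have "?wt (chain_flip j 0 x) = root_reflection (simple P j) (?wt x)" if "x \<in> elems R" for x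
      using subsystem_wt_flip[OF fs assms(4) j that, of 0] by simp
    ultimately show "\<exists>\<phi>. bij_betw \<phi> (elems R) (elems R)
        \<and> (\<forall>x\<in>elems R. ?wt (\<phi> x) = root_reflection (simple P j) (?wt x))"
      by blast
  qed

  \<comment> \<open>Cancellation outside the maximal set\<close>
  have cancel: "(\<Sum>x\<in>N. ?A (\<nu> + ?\<rho> + ?wt x)) = 0"
  proof -
    \<comment> \<open>The number of elements cut off is the pairing of
      \<open>\<nu> + ?\<rho>\<close> with the coroot of color \<open>\<kappa> x\<close>; with this
      shift the flip reflects the whole vector \<open>\<nu> + ?\<rho> + ?wt x\<close>.\<close>
    define \<psi> where "\<psi> x = chain_flip (\<kappa> x) (n (\<kappa> x) + 1) x" for x
    have col: "\<kappa> x \<in> J" if "x \<in> N" for x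
      using assms(6) that by (auto simp: poset_coloring_def N_def)
    have comp: "{y \<in> color_comp R (\<kappa> x) x. y \<notin> ?M \<and> \<kappa> y = \<kappa> x}
        = {y \<in> color_comp R (\<kappa> x) x. n (\<kappa> x) < comp_depth R (\<kappa> x) y}" if x: "x \<in> N" for x
    proof -
      have "\<kappa> x \<in> colors P" "x \<in> elems R" using col[OF x] x assms(4) by (auto simp: N_def)
      then have "color_comp R (\<kappa> x) x - top_part R (\<kappa> x) x (n (\<kappa> x))
          = {y \<in> color_comp R (\<kappa> x) x. n (\<kappa> x) < comp_depth R (\<kappa> x) y}"
        by (auto simp: top_part_depth)
      then show ?thesis using assms(6) x by (simp add: poset_coloring_def N_def)
    qed
    have N: "\<psi> x \<in> N \<and> \<psi> (\<psi> x) = x \<and> ?A (\<nu> + ?\<rho> + ?wt (\<psi> x)) = - ?A (\<nu> + ?\<rho> + ?wt x)"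
      if x: "x \<in> N" for x
    proof -
      let ?j = "\<kappa> x" and ?p = "n (\<kappa> x) + 1"
      have j: "?j \<in> J" "?j \<in> colors P" and el: "x \<in> elems R" "x \<notin> ?M"
        using col[OF x] x assms(4) by (auto simp: N_def)
      have "x \<in> {y \<in> color_comp R ?j x. y \<notin> ?M \<and> \<kappa> y = ?j}"
        using el color_comp_self by auto
      then have p: "?p \<le> comp_depth R ?j x"
        unfolding comp[OF x] by simp
      note flip = chain_flip[OF j(2) el(1) p]
      \<comment> \<open>The flip stays in the component and below its cut-off top, where the
        coloring condition prescribes the same color. The second flip therefore uses the same chain
        and undoes the first.\<close>
      have "\<psi> x \<in> {y \<in> color_comp R ?j x. y \<notin> ?M \<and> \<kappa> y = ?j}"
        using flip(1,3) unfolding comp[OF x] \<psi>_def by simp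
      then have mem: "\<psi> x \<in> N" "\<kappa> (\<psi> x) = ?j"
        using flip(2) by (auto simp: N_def \<psi>_def)
      then have inv: "\<psi> (\<psi> x) = x"
        using flip(4) by (simp add: \<psi>_def)
      have "\<nu> \<bullet> coroot (simple P ?j) = real (n ?j)" "?\<rho> \<bullet> coroot (simple P ?j) = 1"
        using \<nu>_coroot[OF j(1)] Q.weyl_vector_coroot[of ?j] j(1) by (simp_all add: Qsel)
      then have "\<nu> + ?\<rho> + ?wt (\<psi> x) = root_reflection (simple P ?j) (\<nu> + ?\<rho> + ?wt x)"
        unfolding \<psi>_def subsystem_wt_flip[OF fs assms(4) j(1) el(1) p]
        by (simp add: root_reflection_def inner_add_left algebra_simps)
      then have "?A (\<nu> + ?\<rho> + ?wt (\<psi> x)) = - ?A (\<nu> + ?\<rho> + ?wt x)"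
        using Q.alternant_refl[of ?j "\<nu> + ?\<rho> + ?wt x"] j(1) by (simp add: Qsel)
      then show ?thesis using mem(1) inv by blast
    qed
    have "bij_betw \<psi> N N"
      using N by (intro bij_betw_byWitness[where f' = \<psi>]) auto
    then have "(\<Sum>x\<in>N. ?A (\<nu> + ?\<rho> + ?wt x)) = (\<Sum>x\<in>N. ?A (\<nu> + ?\<rho> + ?wt (\<psi> x)))"
      by (rule sum.reindex_bij_betw[symmetric])
    also have "\<dots> = - (\<Sum>x\<in>N. ?A (\<nu> + ?\<rho> + ?wt x))"
      unfolding sum_negf[symmetric] using N by (intro sum.cong) auto
    finally show ?thesis by (rule poly_mapping_eq_uminus_self)
  qed

  \<comment> \<open>Comparison of both sides after multiplication by the alternant of
    \<open>?\<rho>\<close>\<close>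
  have "?A ?\<rho> * (bialternant ?Q \<nu> * restrict_char P J (WGF P R))
      = ?A (\<nu> + ?\<rho>) * (\<Sum>x\<in>elems R. expo (?wt x))"
    using Q.alternant_times_bialternant[OF \<nu>_lat] restrict_char_WGF[OF assms(1,4) finite_elems]
    by (simp add: mult.assoc[symmetric])
  also have "\<dots> = (\<Sum>x\<in>?M. ?A (\<nu> + ?\<rho> + ?wt x))"
    unfolding expand using cancel
      sum.subset_diff[OF M_sub finite_elems, of "\<lambda>x. ?A (\<nu> + ?\<rho> + ?wt x)"]
    by (simp add: N_def)
  also have "\<dots> = (\<Sum>x\<in>?M. ?A ?\<rho> * bialternant ?Q (\<nu> + ?wt x))"
    using Q.alternant_times_bialternant[OF Q.weight_lattice_add[OF \<nu>_lat wt_lat]]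
    by (simp add: add_ac)
  finally have "?A ?\<rho> * (bialternant ?Q \<nu> * restrict_char P J (WGF P R)
      - (\<Sum>x\<in>?M. bialternant ?Q (\<nu> + ?wt x))) = 0"
    by (simp add: right_diff_distrib sum_distrib_left)
  from Q.alternant_weyl_vector_cancel[OF this]
  have eq: "bialternant ?Q \<nu> * restrict_char P J (WGF P R)
      = (\<Sum>m\<in>?M. bialternant ?Q (\<nu> + ?wt m))"
    by simp
  then show ?thesis
    using assms(2,4) \<nu>_dom M_sub M_dom by (simp add: splitting_poset_def)
qed

end
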